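(* For $\mu\in\mathbb{R}$ let $M_\mu$ be the operator of convolution on $\ell^2(\mathcal{L})$ by the element $m_\mu=a+a^{-1}+b+b^{-1}-\mu c\in\mathbb{R}[\mathcal{L}]$, where $\mathcal{L}=\mathbb{Z}/2\mathbb{Z}\wr\mathbb{Z}$ is the lamplighter group with the elements $a,b,c$ described in the context. Then for every $\mu\in\mathbb{R}$ the operator $M_\mu$ has pure point spectrum. Moreover: (a) If $|\mu|\le 1$, the eigenvalues of $M_\mu$ densely pack the interval $[-4-\mu,4-\mu]$ (i.e. the set of eigenvalues is a dense subset of this interval). (b) If $|\mu|>1$, the eigenvalues of $M_\mu$ form a countable set that densely packs the interval $[-4-\mu,4-\mu]$ (i.e. the eigenvalues lying in this interval are dense in it) and that also has an accumulation point $\mu+2/\mu\notin[-4-\mu,4-\mu]$.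
   Context: The lamplighter group is $\mathcal{L}=\mathbb{Z}/2\mathbb{Z}\wr\mathbb{Z}=\left(\bigoplus_{\mathbb{Z}}\mathbb{Z}/2\mathbb{Z}\right)\rtimes\mathbb{Z}$, where a generator $a$ of $\mathbb{Z}$ acts on $\bigoplus_{\mathbb{Z}}\mathbb{Z}/2\mathbb{Z}$ by the automorphism induced by the shift of the index set $\mathbb{Z}$. The element $c$ (of order $2$) is $(\ldots,0,0,1,0,0,\ldots)\in\bigoplus_{\mathbb{Z}}\mathbb{Z}/2\mathbb{Z}$ with the entry $1$ at position $0$, and $b\in\mathcal{L}$ is determined by $c=b^{-1}a$ (so $b=ac$). The operator of convolution by an element of the group algebra is its image under the (left) regular representation on $\ell^2(\mathcal{L})$. For real $\mu$ the operator $M_\mu$ is bounded and self-adjoint. "Pure point spectrum" means that $\ell^2(\mathcal{L})$ has an orthonormal basis of eigenvectors of $M_\mu$ (equivalently, all spectral measures of $M_\mu$ are purely atomic). *)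

theory Defs
  imports
    "HOL-Analysis.Analysis"
    "HOL-Algebra.Group"
    "HOL-Library.Poly_Mapping"
    "HOL-Library.Z2"
begin

section \<open>The lamplighter group\<close>

text \<open>An element \<open>(f, n)\<close> consists of a finitely supported lamp configuration \<open>f\<close>, i.e. an element
  of the direct sum of copies of \<open>\<int>/2\<int>\<close> over \<open>\<int>\<close>, and of an element \<open>n\<close> of the acting group \<open>\<int>\<close>.\<close>

type_synonym lamplighter = "(int \<Rightarrow>\<^sub>0 bit) \<times> int"

text \<open>The entry of \<open>f\<close> at position \<open>i\<close> is moved to position \<open>i + n\<close>.\<close>

definition shift :: "int \<Rightarrow> (int \<Rightarrow>\<^sub>0 bit) \<Rightarrow> (int \<Rightarrow>\<^sub>0 bit)" where
  "shift n f = Poly_Mapping.map_key (\<lambda>i. i - n) f"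

definition lamplighter_group :: "lamplighter monoid" (\<open>\<L>\<close>) where
  "\<L> = \<lparr>carrier = UNIV,
        mult = (\<lambda>(f, m) (g, n). (f + shift m g, m + n)),
        one = (0, 0)\<rparr>"

definition gen_a :: lamplighter where
  "gen_a = (0, 1)"

definition gen_c :: lamplighter where
  "gen_c = (Poly_Mapping.single 0 1, 0)"

definition gen_b :: lamplighter where
  "gen_b = gen_a \<otimes>\<^bsub>\<L>\<^esub> gen_c"

lemma lookup_shift: "Poly_Mapping.lookup (shift n f) i = Poly_Mapping.lookup f (i - n)"
  unfolding shift_def by (subst map_key.rep_eq) (auto simp: inj_def)

lemma shift_add: "shift n (f + g) = shift n f + shift n g"
  by (rule poly_mapping_eqI) (simp add: lookup_shift lookup_add)

lemma shift_shift: "shift m (shift n f) = shift (m + n) f"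
  by (rule poly_mapping_eqI) (simp add: lookup_shift algebra_simps)

lemma shift_0 [simp]: "shift 0 f = f"
  by (rule poly_mapping_eqI) (simp add: lookup_shift)

lemma shift_zero [simp]: "shift n 0 = 0"
  by (rule poly_mapping_eqI) (simp add: lookup_shift)

lemma lamps_add_self [simp]: "f + f = 0" for f :: "int \<Rightarrow>\<^sub>0 bit"
proof (rule poly_mapping_eqI)
  fix i
  show "Poly_Mapping.lookup (f + f) i = Poly_Mapping.lookup 0 i"
    by (cases "Poly_Mapping.lookup f i") (simp_all only: lookup_add lookup_zero, simp_all)
qed

lemma carrier_lamplighter [simp]: "carrier \<L> = UNIV"
  and mult_lamplighter: "(f, m) \<otimes>\<^bsub>\<L>\<^esub> (g, n) = (f + shift m g, m + n)"
  and one_lamplighter: "\<one>\<^bsub>\<L>\<^esub> = (0, 0)"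
  by (simp_all add: lamplighter_group_def)

lemma group_lamplighter: "group \<L>"
proof (rule groupI)
  fix x assume "x \<in> carrier \<L>"
  obtain f m where x: "x = (f, m)" by (cases x)
  have "(shift (- m) f, - m) \<otimes>\<^bsub>\<L>\<^esub> x = \<one>\<^bsub>\<L>\<^esub>"
    by (simp add: x mult_lamplighter one_lamplighter)
  then show "\<exists>y\<in>carrier \<L>. y \<otimes>\<^bsub>\<L>\<^esub> x = \<one>\<^bsub>\<L>\<^esub>"
    by auto
qed (auto simp: mult_lamplighter one_lamplighter shift_add shift_shift add.assoc split_paired_all)

lemma inv_lamplighter: "inv\<^bsub>\<L>\<^esub> (f, m) = (shift (- m) f, - m)"
  by (rule group.inv_equality[OF group_lamplighter])
    (simp_all add: mult_lamplighter one_lamplighter)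

lemma gen_c_eq: "gen_c = inv\<^bsub>\<L>\<^esub> gen_b \<otimes>\<^bsub>\<L>\<^esub> gen_a"
  by (simp add: gen_a_def gen_b_def gen_c_def mult_lamplighter inv_lamplighter shift_shift)

lemma gen_c_order_2: "gen_c \<noteq> \<one>\<^bsub>\<L>\<^esub>" "gen_c \<otimes>\<^bsub>\<L>\<^esub> gen_c = \<one>\<^bsub>\<L>\<^esub>"
  by (simp_all add: gen_c_def mult_lamplighter one_lamplighter)

section \<open>The group algebra and its regular representation\<close>

definition m_elem :: "real \<Rightarrow> (lamplighter \<Rightarrow>\<^sub>0 real)" where
  "m_elem \<mu> =
     Poly_Mapping.single gen_a 1 + Poly_Mapping.single (inv\<^bsub>\<L>\<^esub> gen_a) 1
     + Poly_Mapping.single gen_b 1 + Poly_Mapping.single (inv\<^bsub>\<L>\<^esub> gen_b) 1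
     - Poly_Mapping.single gen_c \<mu>"

text \<open>The linear extension of the left regular representation \<open>(\<lambda>\<^sub>g f)(x) = f(g\<^sup>-\<^sup>1x)\<close>.\<close>

definition conv_op :: "(lamplighter \<Rightarrow>\<^sub>0 real) \<Rightarrow> (lamplighter \<Rightarrow> complex) \<Rightarrow> (lamplighter \<Rightarrow> complex)" where
  "conv_op m f = (\<lambda>x. \<Sum>g\<in>Poly_Mapping.keys m.
     of_real (Poly_Mapping.lookup m g) * f (inv\<^bsub>\<L>\<^esub> g \<otimes>\<^bsub>\<L>\<^esub> x))"

definition M_op :: "real \<Rightarrow> (lamplighter \<Rightarrow> complex) \<Rightarrow> (lamplighter \<Rightarrow> complex)" where
  "M_op \<mu> = conv_op (m_elem \<mu>)"

section \<open>Square-summable functions and point spectrum\<close>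

definition ell2 :: "('a \<Rightarrow> complex) set" where
  "ell2 = {f. (\<lambda>x. (cmod (f x))\<^sup>2) summable_on UNIV}"

definition ell2_inner :: "('a \<Rightarrow> complex) \<Rightarrow> ('a \<Rightarrow> complex) \<Rightarrow> complex" where
  "ell2_inner f g = (\<Sum>\<^sub>\<infinity>x. f x * cnj (g x))"

definition ell2_norm :: "('a \<Rightarrow> complex) \<Rightarrow> real" where
  "ell2_norm f = sqrt (\<Sum>\<^sub>\<infinity>x. (cmod (f x))\<^sup>2)"

definition ell2_orthonormal :: "('a \<Rightarrow> complex) set \<Rightarrow> bool" where
  "ell2_orthonormal B \<longleftrightarrow>
     B \<subseteq> ell2 \<and> (\<forall>u\<in>B. \<forall>v\<in>B. ell2_inner u v = (if u = v then 1 else 0))"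

text \<open>An orthonormal (Hilbert) basis: an orthonormal set with dense linear span.\<close>

definition ell2_orthonormal_basis :: "('a \<Rightarrow> complex) set \<Rightarrow> bool" where
  "ell2_orthonormal_basis B \<longleftrightarrow>
     ell2_orthonormal B \<and>
     (\<forall>f\<in>ell2. \<forall>\<epsilon>>0. \<exists>F k. finite F \<and> F \<subseteq> B \<and>
        ell2_norm (\<lambda>x. f x - (\<Sum>u\<in>F. k u * u x)) < \<epsilon>)"

definition eigenvector ::
    "(('a \<Rightarrow> complex) \<Rightarrow> ('a \<Rightarrow> complex)) \<Rightarrow> complex \<Rightarrow> ('a \<Rightarrow> complex) \<Rightarrow> bool" where
  "eigenvector T z v \<longleftrightarrow> v \<in> ell2 \<and> v \<noteq> (\<lambda>x. 0) \<and> T v = (\<lambda>x. z * v x)"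

definition eigenvalues :: "(('a \<Rightarrow> complex) \<Rightarrow> ('a \<Rightarrow> complex)) \<Rightarrow> complex set" where
  "eigenvalues T = {z. \<exists>v. eigenvector T z v}"

definition pure_point_spectrum :: "(('a \<Rightarrow> complex) \<Rightarrow> ('a \<Rightarrow> complex)) \<Rightarrow> bool" where
  "pure_point_spectrum T \<longleftrightarrow>
     (\<exists>B. ell2_orthonormal_basis B \<and> (\<forall>v\<in>B. \<exists>z. eigenvector T z v))"

end

theory Submission
  imports
    Defs
    "HOL-Computational_Algebra.Fundamental_Theorem_Algebra"
    "HOL-Real_Asymp.Real_Asymp"
begin

text \<open>Write a group element through the coordinates \<open>(h, k)\<close> of its inverse. A character \<open>\<chi>\<close> of the lamp
  group turns \<open>M\<^sub>\<mu>\<close> into a Jacobi operator on \<open>\<int>\<close> whose edge \<open>{k - 1, k}\<close> has weight \<open>1 + \<chi>\<^sub>k \<in> {0, 2}\<close>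
  and whose potential is \<open>-\<mu> \<chi>\<^sub>k\<close>. Almost every \<open>\<chi>\<close> cuts \<open>\<int>\<close> into finite segments, and a segment with \<open>n\<close>
  sites contributes the spectrum of \<open>2 J\<^sub>n - \<mu>\<close>, where \<open>J\<^sub>n\<close> is the adjacency matrix of a path with an
  extra diagonal entry \<open>\<mu>\<close> at its first vertex. The set of \<open>\<chi>\<close> producing a given segment is clopen, so
  the eigenfunctions are finitely supported. The characteristic polynomials of the \<open>J\<^sub>n\<close> are Chebyshev
  combinations: their roots fill \<open>[-2, 2]\<close>, and for \<open>|\<mu>| > 1\<close> one further root tends to \<open>\<mu> + 1 / \<mu>\<close>.\<close>

section \<open>Characteristic polynomials of the segments\<close>

text \<open>This is \<open>det (x - J_n)\<close>, expanded along the last vertex of the path. For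
  fixed \<open>x\<close> the same sequence solves the eigenvector equation from the first vertex on,
  so a root of the \<open>n\<close>-th term makes the entries below \<open>n\<close> an eigenvector.
  The ring is left general because reals, complex numbers and polynomials are all
  substituted.\<close>

fun jac :: "'a::comm_ring_1 \<Rightarrow> 'a \<Rightarrow> nat \<Rightarrow> 'a" where
  "jac m x 0 = 1"
| "jac m x (Suc 0) = x - m"
| "jac m x (Suc (Suc k)) = x * jac m x (Suc k) - jac m x k"

lemma jac_of_real:
  "jac (of_real m) (of_real x) n = (of_real (jac m x n) :: 'a::{comm_ring_1,real_algebra_1})"
  by (induction n rule: induct_nat_012) auto

lemma jac_cnj: "jac (complex_of_real m) (cnj z) n = cnj (jac (of_real m) z n)"
  by (induction n rule: induct_nat_012) auto

lemma jac_uminus: "jac (- m) (- x) n = (- 1) ^ n * jac m x n"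
  by (induction n rule: induct_nat_012) (auto simp: algebra_simps)

text \<open>The three-term recurrence makes the sum telescope. At two distinct common roots of index
  \<open>Suc n\<close> the right side vanishes, which is the orthogonality of eigenvectors without
  any matrices.\<close>

lemma christoffel_darboux:
  "(x - y) * (\<Sum>k\<le>n. jac m x k * jac m y k)
     = jac m x (Suc n) * jac m y n - jac m x n * jac m y (Suc n)"
  by (induction n) (auto simp: algebra_simps)

lemma jac_orthogonal:
  fixes x y :: "'a::idom"
  assumes "jac m x n = 0" "jac m y n = 0" "x \<noteq> y"
  shows "(\<Sum>k<n. jac m x k * jac m y k) = 0"
proof (cases n)
  case (Suc l)
  have "(x - y) * (\<Sum>k<n. jac m x k * jac m y k) = 0"
    using christoffel_darboux[of x y m l] assms by (simp add: Suc lessThan_Suc_atMost)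
  then show ?thesis using assms(3) by simp
qed simp

lemma jac_sum_squares_pos:
  fixes x :: real
  assumes "n > 0"
  shows "(\<Sum>k<n. (jac m x k)\<^sup>2) > 0"
  by (rule sum_pos2[of _ 0]) (use assms in auto)

text \<open>A non-real root and its conjugate would be distinct roots, so orthogonality would make a
  sum of squared moduli vanish, although its term at index 0 is 1.\<close>

lemma jac_root_real:
  fixes z :: complex
  assumes "jac (of_real m) z n = 0"
  shows "z \<in> \<real>"
proof (rule ccontr)
  assume "z \<notin> \<real>"
  then have ne: "z \<noteq> cnj z" by (metis Reals_cnj_iff)
  have "(\<Sum>k<n. jac (of_real m) z k * jac (of_real m) (cnj z) k) = 0"
    by (rule jac_orthogonal) (use assms ne in \<open>auto simp: jac_cnj\<close>)
  then have "complex_of_real (\<Sum>k<n. (cmod (jac (of_real m) z k))\<^sup>2) = 0"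
    by (simp add: jac_cnj complex_norm_square[symmetric])
  then have "(\<Sum>k<n. (cmod (jac (of_real m) z k))\<^sup>2) = 0"
    by (simp only: of_real_eq_0_iff)
  moreover have "n > 0" using assms by (cases n) auto
  then have "(\<Sum>k<n. (cmod (jac (of_real m) z k))\<^sup>2) > 0"
    by (intro sum_pos2[of _ 0]) auto
  ultimately show False by simp
qed

section \<open>Counting the roots through the polynomial form\<close>

lemma poly_jac: "poly (jac [:m:] [:0, 1:] n) x = jac m x n"
  by (induction n rule: induct_nat_012) auto

lemma degree_jac: "degree (jac [:m:] [:0, 1:] n :: 'a::idom poly) = n"
proof (induction n rule: induct_nat_012)
  case (ge2 n)
  let ?q = "jac [:m:] [:0, 1:] (Suc n)"
  have "?q \<noteq> 0" using ge2 by auto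
  then have "degree ([:0, 1:] * ?q) = Suc (Suc n)"
    by (subst degree_mult_eq) (use ge2 in auto)
  then show ?case
    using ge2 degree_add_eq_left[of "- jac [:m:] [:0, 1:] n" "[:0, 1:] * ?q"] by simp
qed auto

text \<open>The limit \<open>y = x\<close> of the Christoffel-Darboux identity, obtained from the
  differentiated recurrence. At a double root of index \<open>Suc n\<close> the right side is 0, so
  it excludes double roots.\<close>

lemma christoffel_darboux_confluent:
  fixes m x :: "'a::idom"
  defines "D \<equiv> \<lambda>k. poly (pderiv (jac [:m:] [:0, 1:] k)) x"
  shows "(\<Sum>k\<le>n. (jac m x k)\<^sup>2) = D (Suc n) * jac m x n - jac m x (Suc n) * D n"
proof (induction n)
  case 0
  show ?case by (simp add: D_def pderiv_diff pderiv_pCons)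
next
  case (Suc n)
  have "D (Suc (Suc n)) = jac m x (Suc n) + x * D (Suc n) - D n"
    by (simp add: D_def pderiv_diff pderiv_mult pderiv_pCons poly_jac del: mult_pCons_left)
  then show ?case
    unfolding sum.atMost_Suc Suc jac.simps(3) by algebra
qed

text \<open>Over the complex numbers there are \<open>n\<close> roots with multiplicity. They are
  simple by the confluent identity and real by \<open>jac_root_real\<close>, so none is lost on
  passing to the real line.\<close>

lemma card_jac_roots:
  fixes m :: real
  shows "card {x. jac m x n = 0} = n"
proof -
  let ?P = "jac [:complex_of_real m:] [:0, 1:] n"
  have n0: "?P \<noteq> 0"
    using poly_jac[of "complex_of_real m" n] degree_jac[of "complex_of_real m" n]
    by (cases n) auto
  have "poly (pderiv ?P) z \<noteq> 0" if z: "poly ?P z = 0" for z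
  proof
    assume d: "poly (pderiv ?P) z = 0"
    have jz: "jac (of_real m) z n = 0" using z by (simp add: poly_jac)
    then obtain l where l: "n = Suc l" by (cases n) auto
    obtain r where r: "z = of_real r" using jac_root_real[OF jz] by (auto elim: Reals_cases)
    \<comment> \<open>A double root annihilates both terms of the confluent identity; as
      \<open>z\<close> is real, the left side is a positive sum of real squares.\<close>
    have "(\<Sum>k\<le>l. (jac (of_real m) z k)\<^sup>2) = 0"
      using christoffel_darboux_confluent[of "of_real m" z l] d jz l by simp
    then have "complex_of_real (\<Sum>k<n. (jac m r k)\<^sup>2) = 0"
      by (simp add: r l jac_of_real lessThan_Suc_atMost)
    then show False
      using jac_sum_squares_pos[of n m r] l by (simp only: of_real_eq_0_iff) simp
  qed
  then have sq: "rsquarefree ?P" by (auto simp: rsquarefree_roots)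
  have "n = size (proots ?P)" by (simp add: size_proots_complex degree_jac)
  also have "\<dots> = (\<Sum>z\<in>{z. poly ?P z = 0}. 1)"
    unfolding size_multiset_overloaded_eq set_count_proots[OF n0]
    by (intro sum.cong) (auto simp: n0 rsquarefree_root_order[OF sq _ n0])
  also have "\<dots> = card {z. jac (complex_of_real m) z n = 0}"
    by (simp add: poly_jac)
  also have "{z. jac (complex_of_real m) z n = 0} = complex_of_real ` {x. jac m x n = 0}"
  proof (intro equalityI subsetI)
    fix z assume z: "z \<in> {z. jac (complex_of_real m) z n = 0}"
    then obtain r where r: "z = of_real r" using jac_root_real[of m z n] by (auto elim: Reals_cases)
    then show "z \<in> complex_of_real ` {x. jac m x n = 0}" using z by (auto simp: jac_of_real)
  qed (auto simp: jac_of_real)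
  also have "card \<dots> = card {x. jac m x n = 0}"
    by (rule card_image) (auto simp: inj_on_def)
  finally show ?thesis by simp
qed

lemma finite_jac_roots:
  fixes m :: real
  shows "finite {x. jac m x n = 0}"
  using card_jac_roots[of m n] by (cases n) (auto intro: card_ge_0_finite)

text \<open>A Gershgorin argument: for \<open>\<bar>m\<bar> \<le> 1\<close> every row of
  \<open>J_n\<close> has absolute sum at most 2, and the row of a largest entry of the eigenvector
  gives the bound.\<close>

lemma jac_eigen_bound:
  fixes m x :: real
  assumes "jac m x n = 0" "\<bar>m\<bar> \<le> 1"
  shows "\<bar>x\<bar> \<le> 2"
proof -
  obtain l where l: "n = Suc l" using assms(1) by (cases n) auto
  define u where "u = (\<lambda>k. \<bar>jac m x k\<bar>)"
  define M where "M = Max (u ` {..l})"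
  have M: "u k \<le> M" if "k \<le> l" for k using that by (auto simp: M_def)
  have "M \<in> u ` {..l}" unfolding M_def by (intro Max_in) auto
  then obtain k where k: "k \<le> l" "u k = M" by auto
  have "M > 0" using M[of 0] by (simp add: u_def)
  have step: "x * jac m x 0 = m * jac m x 0 + jac m x 1"
    "\<And>j. x * jac m x (Suc j) = jac m x j + jac m x (Suc (Suc j))" by auto
  \<comment> \<open>For the last vertex the next term is the root condition, hence 0.\<close>
  have nx: "u (Suc k) \<le> M"
    using M[of "Suc k"] k(1) l assms(1) \<open>M > 0\<close>
    by (cases "k = l") (auto simp: u_def)
  have "\<bar>x\<bar> * u k \<le> M + M"
  proof (cases k)
    case 0
    have "\<bar>x * jac m x 0\<bar> \<le> \<bar>m\<bar> * \<bar>jac m x 0\<bar> + \<bar>jac m x 1\<bar>"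
      unfolding step by (metis abs_mult abs_triangle_ineq)
    moreover have "\<bar>m\<bar> * \<bar>jac m x 0\<bar> \<le> u 0"
      unfolding u_def using assms(2) by simp
    ultimately show ?thesis using nx M[of 0] by (simp add: 0 u_def)
  next
    case (Suc j)
    have "\<bar>x * jac m x (Suc j)\<bar> \<le> \<bar>jac m x j\<bar> + \<bar>jac m x (Suc (Suc j))\<bar>"
      unfolding step by (rule abs_triangle_ineq)
    then show ?thesis using nx M[of j] k Suc by (simp add: u_def abs_mult)
  qed
  then have "\<bar>x\<bar> * M \<le> 2 * M" using k by simp
  then show ?thesis using \<open>M > 0\<close> by simp
qed

section \<open>Location of the roots\<close>

text \<open>In terms of Chebyshev polynomials of the second kind, \<open>jac\<close> is
  \<open>U_n - m U_(n-1)\<close>. Multiplying by \<open>sin t\<close> keeps the identity valid where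
  the sine vanishes.\<close>

lemma jac_cos:
  fixes m t :: real
  shows "jac m (2 * cos t) n * sin t = sin (real (Suc n) * t) - m * sin (real n * t)"
proof (induction n rule: induct_nat_012)
  case 1
  show ?case using sin_double[of t] by (simp add: algebra_simps)
next
  case (ge2 n)
  have *: "sin (real (Suc (Suc k)) * t) = 2 * cos t * sin (real (Suc k) * t) - sin (real k * t)" for k
  proof -
    have "sin (real (Suc k) * t + t) + sin (real (Suc k) * t - t) = 2 * cos t * sin (real (Suc k) * t)"
      by (simp add: sin_add sin_diff)
    then show ?thesis by (simp add: algebra_simps)
  qed
  have "jac m (2 * cos t) (Suc (Suc n)) * sin t
      = 2 * cos t * (jac m (2 * cos t) (Suc n) * sin t) - jac m (2 * cos t) n * sin t"
    by (simp add: algebra_simps)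
  then show ?case unfolding ge2 * [of "Suc n"] * [of n] by (simp add: algebra_simps del: of_nat_Suc)
qed simp

text \<open>At the angles \<open>i pi / N\<close> the term with \<open>m\<close> vanishes and the
  rest is \<open>(-1)^i\<close> times a sine. The signs therefore alternate whatever
  \<open>m\<close> is, and each interior grid cell contains the angle of a root.\<close>

lemma jac_roots_dense:
  fixes m y :: real
  assumes "\<bar>y\<bar> \<le> 2" "e > 0"
  shows "\<exists>n x. n > 0 \<and> jac m x n = 0 \<and> \<bar>x\<bar> \<le> 2 \<and> \<bar>x - y\<bar> < e"
proof -
  define t where "t = arccos (y / 2)"
  have t: "0 \<le> t" "t \<le> pi" "y = 2 * cos t"
    unfolding t_def using assms by (auto intro!: arccos_lbound arccos_ubound simp: cos_arccos)
  \<comment> \<open>The mesh is fine enough for a few cells to fit within the tolerance, and the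
    summand 3 leaves room for two neighbouring interior grid points.\<close>
  define N where "N = nat \<lceil>8 * pi / e\<rceil> + 3"
  have N: "8 * pi / e < real N" "N \<ge> 3" unfolding N_def by linarith+
  have NN: "4 * pi / N < e / 2"
    using N assms by (simp add: field_simps)
  \<comment> \<open>The grid index just below the target angle, clamped so that both
    \<open>j\<close> and \<open>Suc j\<close> are interior. Rounding and clamping together move it
    by at most two cells.\<close>
  define j where "j = max 1 (min (N - 2) (nat \<lfloor>t * N / pi\<rfloor>))"
  have j: "1 \<le> j" "j \<le> N - 2" using N by (auto simp: j_def)
  have f: "real (nat \<lfloor>t * N / pi\<rfloor>) \<le> t * N / pi" "t * N / pi < real (nat \<lfloor>t * N / pi\<rfloor>) + 1"
  proof -
    have "t * N / pi \<ge> 0" using t by simp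
    then show "real (nat \<lfloor>t * N / pi\<rfloor>) \<le> t * N / pi" "t * N / pi < real (nat \<lfloor>t * N / pi\<rfloor>) + 1"
      by linarith+
  qed
  have fN: "t * N / pi \<le> N" using t by (simp add: field_simps mult_right_mono)
  have close: "\<bar>real j - t * N / pi\<bar> \<le> 2"
  proof -
    have "nat \<lfloor>t * N / pi\<rfloor> \<le> N" using f(1) fN by linarith
    then have "\<bar>real j - real (nat \<lfloor>t * N / pi\<rfloor>)\<bar> \<le> 2 \<and> (nat \<lfloor>t * N / pi\<rfloor> \<le> N - 2 \<longrightarrow> real j \<le> real (nat \<lfloor>t * N / pi\<rfloor>) + 1 \<and> real j \<ge> real (nat \<lfloor>t * N / pi\<rfloor>)) \<and> (nat \<lfloor>t * N / pi\<rfloor> > N - 2 \<longrightarrow> j = N - 2)"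
      using N unfolding j_def by linarith
    then show ?thesis using f fN N by linarith
  qed
  let ?g = "\<lambda>s. sin (real (Suc N) * s) - m * sin (real N * s)"
  have val: "?g (real i * pi / N) = (- 1) ^ i * sin (real i * pi / N)" for i
  proof -
    have "real N * (real i * pi / N) = real i * pi" using N by simp
    moreover have "real (Suc N) * (real i * pi / N) = real i * pi + real i * pi / N"
      using N by (simp add: field_simps)
    ultimately show ?thesis by (simp add: sin_add cos_npi sin_npi)
  qed
  have pos: "sin (real i * pi / N) > 0" if "1 \<le> i" "i < N" for i
    by (rule sin_gt_zero) (use that N in \<open>auto simp: field_simps\<close>)
  let ?a = "real j * pi / N" and ?b = "real (Suc j) * pi / N"
  have ab: "?a \<le> ?b" using N by (simp add: divide_right_mono)
  have cont: "continuous_on {?a..?b} ?g" by (intro continuous_intros)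
  have "?g ?a * ?g ?b = - (sin ?a * sin ?b)"
    unfolding val by (cases "even j") (auto simp del: of_nat_Suc)
  then have "?g ?a * ?g ?b < 0"
    using pos[of j] pos[of "Suc j"] j N by simp
  then have "\<exists>s. ?a \<le> s \<and> s \<le> ?b \<and> ?g s = 0"
    using IVT'[of ?g ?a 0 ?b, OF _ _ ab cont] IVT2'[of ?g ?b 0 ?a, OF _ _ ab cont]
    by (auto simp: mult_less_0_iff)
  then obtain s where s: "?a \<le> s" "s \<le> ?b" "?g s = 0" by blast
  have "0 < ?a" using j N by simp
  moreover have "?b < pi"
  proof -
    have "real (Suc j) < real N" using j N by linarith
    then have "real (Suc j) * pi < real N * pi" by (intro mult_strict_right_mono) auto
    then show ?thesis using N by (simp add: field_simps)
  qed
  ultimately have "sin s > 0" using s by (intro sin_gt_zero) auto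
  then have root: "jac m (2 * cos s) N = 0" using jac_cos[of m s N] s(3) by simp
  have "\<bar>?a - t\<bar> \<le> 2 * (pi / N)"
  proof -
    have "?a - t = (real j - t * N / pi) * (pi / N)" using N by (simp add: field_simps)
    then have "\<bar>?a - t\<bar> = \<bar>real j - t * N / pi\<bar> * (pi / N)" by (simp add: abs_mult)
    also have "\<dots> \<le> 2 * (pi / N)" by (intro mult_right_mono close) auto
    finally show ?thesis .
  qed
  moreover have "?b = ?a + pi / N" by (simp add: field_simps add_divide_distrib)
  moreover have "4 * (pi / N) < e / 2" "pi / N \<ge> 0" using NN by simp_all
  moreover have "\<bar>s - t\<bar> < e / 2"
    if "\<bar>a - t\<bar> \<le> 2 * d" "b = a + d" "4 * d < e / 2" "d \<ge> 0" "a \<le> s" "s \<le> b" for a b d :: real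
    using that by linarith
  ultimately have st: "\<bar>s - t\<bar> < e / 2" using s(1,2) by blast
  \<comment> \<open>The cosine is 1-Lipschitz, so the factor 2 in \<open>2 * cos s\<close> is what
    the tolerance \<open>e / 2\<close> for angles pays for.\<close>
  have "\<bar>cos s - cos t\<bar> \<le> \<bar>s - t\<bar>"
  proof -
    have "\<bar>cos s - cos t\<bar> = 2 * (\<bar>sin ((s + t) / 2)\<bar> * \<bar>sin ((t - s) / 2)\<bar>)"
      unfolding cos_diff_cos by (simp only: abs_mult abs_numeral mult.assoc)
    also have "\<dots> \<le> 2 * (1 * \<bar>(t - s) / 2\<bar>)"
      by (intro mult_left_mono mult_mono abs_sin_x_le_abs_x) auto
    finally show ?thesis by simp
  qed
  then have "\<bar>2 * cos s - y\<bar> < e" using st t by linarith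
  moreover have "\<bar>2 * cos s\<bar> \<le> 2" using abs_cos_le_one[of s] by linarith
  ultimately show ?thesis using root N by (intro exI[of _ N] exI[of _ "2 * cos s"]) auto
qed

text \<open>With \<open>x = s + 1 / s\<close> the recurrence has the solutions \<open>s ^ n\<close>
  and \<open>(1 / s) ^ n\<close>. The coefficient of the first vanishes at \<open>s = m\<close>,
  which singles out \<open>m + 1 / m\<close> as the limit of the outer roots.\<close>

lemma jac_joukowsky:
  fixes m s :: real
  assumes "s \<noteq> 0"
  shows "jac m (s + 1 / s) n * (s - 1 / s) = s ^ n * (s - m) - (1 / s) ^ n * (1 / s - m)"
proof (induction n rule: induct_nat_012)
  case (ge2 n)
  define q where "q = 1 / s"
  \<comment> \<open>The powers are replaced by free variables tied by two relations, which leaves a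
    polynomial identity.\<close>
  have gen: "(s + q) * (S' * (s - m) - Q' * (q - m)) - (S * (s - m) - Q * (q - m))
      = s * S' * (s - m) - q * Q' * (q - m)" if "q * S' = S" "s * Q' = Q" for S S' Q Q'
    unfolding that[symmetric] by algebra
  have "q * s ^ Suc n = s ^ n" "s * q ^ Suc n = q ^ n"
    using assms by (simp_all add: q_def)
  from gen[OF this] have "(s + q) * (s ^ Suc n * (s - m) - q ^ Suc n * (q - m)) - (s ^ n * (s - m) - q ^ n * (q - m))
      = s ^ Suc (Suc n) * (s - m) - q ^ Suc (Suc n) * (q - m)"
    by (simp only: power_Suc[of _ "Suc n"])
  moreover have "jac m (s + q) (Suc (Suc n)) * (s - q)
      = (s + q) * (jac m (s + q) (Suc n) * (s - q)) - jac m (s + q) n * (s - q)"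
    by (simp add: algebra_simps)
  ultimately show ?case using ge2 by (simp only: q_def)
qed (use assms in \<open>auto simp: field_simps\<close>)

text \<open>At \<open>s = m\<close> only the positive decaying term survives. At a slightly smaller
  \<open>s > 1\<close> the growing term is negative and dominates for large \<open>n\<close>, so a
  root lies between the two values of \<open>s + 1 / s\<close>.\<close>

lemma jac_outer_root:
  fixes m e :: real
  assumes "m > 1" "e > 0"
  shows "\<exists>n x. n > 0 \<and> jac m x n = 0 \<and> x \<noteq> m + 1 / m \<and> \<bar>x - (m + 1 / m)\<bar> < e"
proof -
  \<comment> \<open>The first bound keeps \<open>s\<close> above 1, the second keeps it within
    \<open>e\<close> of \<open>m\<close>. Since \<open>1 / m < 1 / s\<close>, the values
    \<open>s + 1 / s\<close> and \<open>m + 1 / m\<close> are even closer.\<close>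
  define s where "s = max ((1 + m) / 2) (m - e / 2)"
  have s: "1 < s" "s < m" "m - s < e" using assms by (auto simp: s_def max_def field_simps)
  have s1: "1 / s < 1" "1 / s < s" using s by (simp_all add: field_simps) (smt (verit) mult_less_cancel_left2 s(1))
  \<comment> \<open>The exponent makes the growing term exceed \<open>m\<close>, a bound for the
    decaying one.\<close>
  obtain n where n: "m / (m - s) < s ^ n" using real_arch_pow[OF s(1)] by blast
  have "(m / (m - s)) < s ^ Suc n"
  proof -
    have "s ^ n \<le> s ^ Suc n" using s by (intro power_increasing) auto
    then show ?thesis using n by linarith
  qed
  then have "m < s ^ Suc n * (m - s)" using s by (simp add: field_simps)
  moreover have "(1 / s) ^ Suc n * (m - 1 / s) \<le> 1 * m"
    using s s1 by (intro mult_mono power_le_one) auto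
  ultimately have "jac m (s + 1 / s) (Suc n) * (s - 1 / s) < 0"
    by (subst jac_joukowsky) (use s in \<open>auto simp: right_diff_distrib simp del: power_Suc\<close>)
  then have neg: "jac m (s + 1 / s) (Suc n) < 0"
    using s1 by (simp add: mult_less_0_iff)
  have "1 / m < m" using assms by (simp add: field_simps) (smt (verit) mult_less_cancel_left2)
  moreover have "jac m (m + 1 / m) (Suc n) * (m - 1 / m) > 0"
    by (subst jac_joukowsky)
      (use assms \<open>1 / m < m\<close> in \<open>auto intro!: divide_neg_pos mult_pos_neg\<close>)
  ultimately have pos: "jac m (m + 1 / m) (Suc n) > 0"
    by (simp add: zero_less_mult_iff)
  have lt: "s + 1 / s < m + 1 / m"
  proof -
    have "m + 1 / m - (s + 1 / s) = (m - s) * (1 - 1 / (m * s))"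
      using s by (simp add: field_simps)
    moreover have "1 / (m * s) < 1" using s assms by (simp add: field_simps) (smt (verit) mult_less_cancel_left2 s(1))
    ultimately show ?thesis using s by (smt (verit) mult_pos_pos)
  qed
  have cont: "continuous_on {s + 1 / s..m + 1 / m} (\<lambda>x. jac m x (Suc n))"
  proof -
    have "continuous_on {s + 1 / s..m + 1 / m} (\<lambda>x. poly (jac [:m:] [:0, 1:] (Suc n)) x)"
      by (intro continuous_intros)
    then show ?thesis by (simp only: poly_jac)
  qed
  obtain x where x: "s + 1 / s \<le> x" "x \<le> m + 1 / m" "jac m x (Suc n) = 0"
    using IVT'[OF less_imp_le[OF neg] less_imp_le[OF pos] less_imp_le[OF lt] cont] by blast
  have "x \<noteq> m + 1 / m" using x pos by auto
  moreover have "1 / m < 1 / s" using s by (simp add: field_simps)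
  ultimately show ?thesis using x s by (intro exI[of _ "Suc n"] exI[of _ x]) auto
qed

text \<open>Negative \<open>m\<close> is reduced to the positive case by the parity relation
  \<open>jac_uminus\<close>.\<close>

lemma jac_outer_root_abs:
  fixes m e :: real
  assumes "\<bar>m\<bar> > 1" "e > 0"
  shows "\<exists>n x. n > 0 \<and> jac m x n = 0 \<and> x \<noteq> m + 1 / m \<and> \<bar>x - (m + 1 / m)\<bar> < e"
proof (cases "m > 0")
  case True
  then show ?thesis using jac_outer_root[of m e] assms by simp
next
  case False
  then obtain n x where "n > 0" "jac (- m) x n = 0" "x \<noteq> - m + 1 / (- m)" "\<bar>x - (- m + 1 / (- m))\<bar> < e"
    using jac_outer_root[of "- m" e] assms by auto
  then show ?thesis
    using jac_uminus[of m "- x" n] by (intro exI[of _ n] exI[of _ "- x"]) auto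
qed

section \<open>Normalised eigenvectors of a segment\<close>

definition jvec :: "real \<Rightarrow> nat \<Rightarrow> real \<Rightarrow> nat \<Rightarrow> real" where
  "jvec m n x k = jac m x k / sqrt (\<Sum>i<n. (jac m x i)\<^sup>2)"

lemma jvec_orthonormal:
  assumes "jac m x n = 0" "jac m y n = 0"
  shows "(\<Sum>k<n. jvec m n x k * jvec m n y k) = (if x = y then 1 else 0)"
proof -
  have "n > 0" using assms by (cases n) auto
  have "(\<Sum>k<n. jvec m n x k * jvec m n y k) = (\<Sum>k<n. jac m x k * jac m y k)
      / (sqrt (\<Sum>i<n. (jac m x i)\<^sup>2) * sqrt (\<Sum>i<n. (jac m y i)\<^sup>2))"
    by (simp add: jvec_def sum_divide_distrib)
  then show ?thesis
    using jac_orthogonal[OF assms] jac_sum_squares_pos[OF \<open>n > 0\<close>, of m x]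
    by (auto simp: power2_eq_square)
qed

text \<open>The Pythagorean formula for the distance from a point mass to its orthogonal projection.
  It serves twice: for the vectors of one segment, and later for the eigenfunctions on the
  group.\<close>

lemma bessel_expand:
  fixes u :: "'b \<Rightarrow> 'a \<Rightarrow> real"
  assumes "finite S" "finite F" "a \<in> S"
    and "\<And>i j. i \<in> F \<Longrightarrow> j \<in> F \<Longrightarrow> (\<Sum>y\<in>S. u i y * u j y) = (if i = j then 1 else 0)"
  shows "(\<Sum>y\<in>S. ((if y = a then 1 else 0) - (\<Sum>i\<in>F. u i a * u i y))\<^sup>2) = 1 - (\<Sum>i\<in>F. (u i a)\<^sup>2)"
proof -
  have "(\<Sum>y\<in>S. ((if y = a then 1 else 0) - (\<Sum>i\<in>F. u i a * u i y))\<^sup>2)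
     = (\<Sum>y\<in>S. (if y = a then 1 else 0) - 2 * (if y = a then \<Sum>i\<in>F. u i a * u i y else 0)
          + (\<Sum>i\<in>F. u i a * u i y) * (\<Sum>j\<in>F. u j a * u j y))"
    by (intro sum.cong) (auto simp: power2_eq_square algebra_simps)
  also have "\<dots> = 1 - 2 * (\<Sum>i\<in>F. u i a * u i a)
       + (\<Sum>y\<in>S. (\<Sum>i\<in>F. u i a * u i y) * (\<Sum>j\<in>F. u j a * u j y))"
    using assms by (simp add: sum.distrib sum_subtractf flip: sum_distrib_left)
  also have "(\<Sum>y\<in>S. (\<Sum>i\<in>F. u i a * u i y) * (\<Sum>j\<in>F. u j a * u j y))
     = (\<Sum>y\<in>S. \<Sum>i\<in>F. \<Sum>j\<in>F. u i a * u j a * (u i y * u j y))"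
    by (simp add: sum_product mult_ac)
  also have "\<dots> = (\<Sum>i\<in>F. \<Sum>j\<in>F. u i a * u j a * (\<Sum>y\<in>S. u i y * u j y))"
    by (subst sum.swap, intro sum.cong refl, subst sum.swap) (simp add: sum_distrib_left)
  also have "\<dots> = (\<Sum>i\<in>F. \<Sum>j\<in>F. u i a * u j a * (if i = j then 1 else 0))"
    using assms(4) by (intro sum.cong) auto
  also have "\<dots> = (\<Sum>i\<in>F. u i a * u i a)"
    using assms(2) by (intro sum.cong) (auto simp: if_distrib cong: if_cong)
  finally show ?thesis by (simp add: power2_eq_square)
qed

text \<open>By Bessel's inequality each of the \<open>n\<close> sums is at most \<open>1\<close>, while their total is the number
  of roots, which is \<open>n\<close>; so all of them equal \<open>1\<close>.\<close>

lemma jvec_dual_norm: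
  assumes "k < n"
  shows "(\<Sum>x | jac m x n = 0. (jvec m n x k)\<^sup>2) = 1"
proof -
  let ?R = "{x. jac m x n = 0}"
  define s where "s = (\<lambda>k. \<Sum>x\<in>?R. (jvec m n x k)\<^sup>2)"
  have le: "s k \<le> 1" if "k < n" for k
  proof -
    have "0 \<le> (\<Sum>y<n. ((if y = k then 1 else 0) - (\<Sum>x\<in>?R. jvec m n x k * jvec m n x y))\<^sup>2)"
      by (intro sum_nonneg) auto
    also have "\<dots> = 1 - s k"
      unfolding s_def using that
      by (intro bessel_expand) (auto simp: finite_jac_roots jvec_orthonormal)
    finally show ?thesis by simp
  qed
  have "(\<Sum>k<n. s k) = (\<Sum>x\<in>?R. \<Sum>k<n. jvec m n x k * jvec m n x k)"
    unfolding s_def by (subst sum.swap) (simp add: power2_eq_square)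
  also have "\<dots> = (\<Sum>x\<in>?R. 1)" by (intro sum.cong refl) (simp add: jvec_orthonormal)
  also have "\<dots> = n" by (simp add: card_jac_roots)
  finally have "(\<Sum>k<n. 1 - s k) = 0" by (simp add: sum_subtractf)
  then have "1 - s k = 0"
    using assms le by (subst (asm) sum_nonneg_eq_0_iff) auto
  then show ?thesis by (simp add: s_def)
qed

section \<open>Square-summable functions\<close>

lemma norm_add_power2_le:
  fixes a b :: "'a::real_normed_vector"
  shows "(norm (a + b))\<^sup>2 \<le> 2 * (norm a)\<^sup>2 + 2 * (norm b)\<^sup>2"
proof -
  have "(norm (a + b))\<^sup>2 \<le> (norm a + norm b)\<^sup>2"
    by (intro power_mono norm_triangle_ineq) auto
  also have "\<dots> \<le> 2 * (norm a)\<^sup>2 + 2 * (norm b)\<^sup>2"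
    using sum_squares_bound[of "norm a" "norm b"] by (simp add: power2_sum)
  finally show ?thesis .
qed

text \<open>Squared norms are used throughout, so the triangle inequality appears with the crude
  factor 2; this is why approximations are taken to within \<open>e / 4\<close>.\<close>

lemma ell2_add:
  assumes "f \<in> ell2" "g \<in> ell2"
  shows "(\<lambda>x. f x + g x) \<in> ell2"
    and "(\<Sum>\<^sub>\<infinity>x. (cmod (f x + g x))\<^sup>2) \<le> 2 * (\<Sum>\<^sub>\<infinity>x. (cmod (f x))\<^sup>2) + 2 * (\<Sum>\<^sub>\<infinity>x. (cmod (g x))\<^sup>2)"
proof -
  have s: "(\<lambda>x. 2 * (cmod (f x))\<^sup>2) summable_on UNIV" "(\<lambda>x. 2 * (cmod (g x))\<^sup>2) summable_on UNIV"
    using assms unfolding ell2_def by (auto intro: summable_on_cmult_right)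
  show *: "(\<lambda>x. f x + g x) \<in> ell2"
    unfolding ell2_def mem_Collect_eq
    by (rule summable_on_comparison_test[OF summable_on_add[OF s]]) (auto simp: norm_add_power2_le)
  have "(\<Sum>\<^sub>\<infinity>x. (cmod (f x + g x))\<^sup>2) \<le> (\<Sum>\<^sub>\<infinity>x. 2 * (cmod (f x))\<^sup>2 + 2 * (cmod (g x))\<^sup>2)"
    using * unfolding ell2_def
    by (intro infsum_mono summable_on_add s) (auto simp: norm_add_power2_le)
  also have "\<dots> = (\<Sum>\<^sub>\<infinity>x. 2 * (cmod (f x))\<^sup>2) + (\<Sum>\<^sub>\<infinity>x. 2 * (cmod (g x))\<^sup>2)"
    by (intro infsum_add s)
  finally show "(\<Sum>\<^sub>\<infinity>x. (cmod (f x + g x))\<^sup>2) \<le> 2 * (\<Sum>\<^sub>\<infinity>x. (cmod (f x))\<^sup>2) + 2 * (\<Sum>\<^sub>\<infinity>x. (cmod (g x))\<^sup>2)"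
    by (simp add: infsum_cmult_right')
qed

lemma ell2_scale:
  assumes "f \<in> ell2"
  shows "(\<lambda>x. c * f x) \<in> ell2"
    and "(\<Sum>\<^sub>\<infinity>x. (cmod (c * f x))\<^sup>2) = (cmod c)\<^sup>2 * (\<Sum>\<^sub>\<infinity>x. (cmod (f x))\<^sup>2)"
  using assms unfolding ell2_def
  by (auto simp: norm_mult power_mult_distrib infsum_cmult_right' intro: summable_on_cmult_right)

lemma ell2_finite_support: "finite {x. f x \<noteq> 0} \<Longrightarrow> f \<in> ell2"
  unfolding ell2_def by (auto intro!: finite_nonzero_values_imp_summable_on)

lemma infsum_finite_support:
  assumes "finite S" "\<And>x. x \<notin> S \<Longrightarrow> f x = 0"
  shows "(\<Sum>\<^sub>\<infinity>x. f x) = (\<Sum>x\<in>S. f x)"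
proof -
  have "(\<Sum>\<^sub>\<infinity>x. f x) = (\<Sum>\<^sub>\<infinity>x\<in>S. f x)"
    using assms(2) by (intro infsum_cong_neutral) auto
  then show ?thesis using assms(1) by simp
qed

lemma has_sum_sum:
  fixes f :: "'i \<Rightarrow> 'a \<Rightarrow> 'b::topological_comm_monoid_add"
  assumes "\<And>i. i \<in> F \<Longrightarrow> (f i has_sum s i) A"
  shows "((\<lambda>x. \<Sum>i\<in>F. f i x) has_sum (\<Sum>i\<in>F. s i)) A"
  using assms by (induction F rule: infinite_finite_induct) (auto intro: has_sum_add)

text \<open>Summands are added one at a time and may repeat, so closure under sums is a plain
  induction. \<open>fspan_imp_sum\<close> collects the coefficients afterwards.\<close>

inductive_set fspan :: "('a \<Rightarrow> complex) set \<Rightarrow> ('a \<Rightarrow> complex) set" for B where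
  zero: "(\<lambda>x. 0) \<in> fspan B"
| add: "g \<in> fspan B \<Longrightarrow> u \<in> B \<Longrightarrow> (\<lambda>x. g x + c * u x) \<in> fspan B"

lemma fspan_add: "g \<in> fspan B \<Longrightarrow> f \<in> fspan B \<Longrightarrow> (\<lambda>x. f x + g x) \<in> fspan B"
  by (induction rule: fspan.induct) (auto simp: add.assoc[symmetric] intro: fspan.add)

lemma fspan_scale: "g \<in> fspan B \<Longrightarrow> (\<lambda>x. a * g x) \<in> fspan B"
proof (induction rule: fspan.induct)
  case (add g u c)
  then show ?case using fspan.add[OF add.IH add.hyps(2), of "a * c"] by (simp add: algebra_simps)
qed (auto intro: fspan.zero)

lemma fspan_sum:
  assumes "finite F" "\<And>i. i \<in> F \<Longrightarrow> u i \<in> B"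
  shows "(\<lambda>x. \<Sum>i\<in>F. c i * u i x) \<in> fspan B"
  using assms
proof (induction F rule: finite_induct)
  case (insert i F)
  then show ?case using fspan.add[of "\<lambda>x. \<Sum>i\<in>F. c i * u i x" B "u i" "c i"] by (simp add: add.commute)
qed (auto intro: fspan.zero)

lemma fspan_imp_sum:
  assumes "g \<in> fspan B"
  shows "\<exists>F k. finite F \<and> F \<subseteq> B \<and> g = (\<lambda>x. \<Sum>u\<in>F. k u * u x)"
  using assms
proof (induction rule: fspan.induct)
  case zero
  show ?case by (rule exI[of _ "{}"]) auto
next
  case (add g u c)
  then obtain F k where F: "finite F" "F \<subseteq> B" "g = (\<lambda>x. \<Sum>u\<in>F. k u * u x)" by blast
  show ?case
  proof (cases "u \<in> F")
    case True
    have "g x + c * u x = (\<Sum>v\<in>F. (k(u := k u + c)) v * v x)" for x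
      using F(1) True by (simp add: F(3) sum.remove[of F u] algebra_simps cong: sum.cong)
        (intro sum.cong, auto)
    then show ?thesis using F by (intro exI[of _ F] exI[of _ "k(u := k u + c)"]) auto
  next
    case False
    have "g x + c * u x = (\<Sum>v\<in>insert u F. (k(u := c)) v * v x)" for x
      using F(1) False by (simp add: F(3) algebra_simps) (intro sum.cong, auto)
    then show ?thesis using F add.hyps by (intro exI[of _ "insert u F"] exI[of _ "k(u := c)"]) auto
  qed
qed

text \<open>That the difference lies in \<open>ell2\<close> is demanded separately: the infinite sum
  of a non-summable family is 0 by convention and would pass for a small distance.\<close>

definition ell2_closure :: "('a \<Rightarrow> complex) set \<Rightarrow> ('a \<Rightarrow> complex) set" where
  "ell2_closure X = {f. \<forall>e>0. \<exists>g\<in>X. (\<lambda>x. f x - g x) \<in> ell2 \<and> (\<Sum>\<^sub>\<infinity>x. (cmod (f x - g x))\<^sup>2) < e}"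

lemma ell2_closureD:
  assumes "f \<in> ell2_closure X" "e > 0"
  obtains g where "g \<in> X" "(\<lambda>x. f x - g x) \<in> ell2" "(\<Sum>\<^sub>\<infinity>x. (cmod (f x - g x))\<^sup>2) < e"
  using assms unfolding ell2_closure_def by blast

lemma ell2_closure_idem: "ell2_closure (ell2_closure X) \<subseteq> ell2_closure X"
proof
  fix f assume f: "f \<in> ell2_closure (ell2_closure X)"
  show "f \<in> ell2_closure X"
    unfolding ell2_closure_def mem_Collect_eq
  proof (intro allI impI)
    fix e :: real assume "e > 0"
    then obtain g where g: "g \<in> ell2_closure X" "(\<lambda>x. f x - g x) \<in> ell2"
      "(\<Sum>\<^sub>\<infinity>x. (cmod (f x - g x))\<^sup>2) < e / 4"
      using ell2_closureD[OF f, of "e / 4"] by auto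
    obtain h where h: "h \<in> X" "(\<lambda>x. g x - h x) \<in> ell2" "(\<Sum>\<^sub>\<infinity>x. (cmod (g x - h x))\<^sup>2) < e / 4"
      using ell2_closureD[OF g(1), of "e / 4"] \<open>e > 0\<close> by auto
    show "\<exists>h\<in>X. (\<lambda>x. f x - h x) \<in> ell2 \<and> (\<Sum>\<^sub>\<infinity>x. (cmod (f x - h x))\<^sup>2) < e"
      using ell2_add[OF g(2) h(2)] g(3) h(1,3) by (intro bexI[of _ h]) auto
  qed
qed

lemma ell2_closure_fspan_add:
  assumes "f \<in> ell2_closure (fspan B)" "g \<in> ell2_closure (fspan B)"
  shows "(\<lambda>x. f x + g x) \<in> ell2_closure (fspan B)"
  unfolding ell2_closure_def mem_Collect_eq
proof (intro allI impI)
  fix e :: real assume "e > 0"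
  then obtain f' where f: "f' \<in> fspan B" "(\<lambda>x. f x - f' x) \<in> ell2" "(\<Sum>\<^sub>\<infinity>x. (cmod (f x - f' x))\<^sup>2) < e / 4"
    using ell2_closureD[OF assms(1), of "e / 4"] by auto
  obtain g' where g: "g' \<in> fspan B" "(\<lambda>x. g x - g' x) \<in> ell2" "(\<Sum>\<^sub>\<infinity>x. (cmod (g x - g' x))\<^sup>2) < e / 4"
    using ell2_closureD[OF assms(2), of "e / 4"] \<open>e > 0\<close> by auto
  have eq: "f x - f' x + (g x - g' x) = f x + g x - (f' x + g' x)" for x by simp
  show "\<exists>h\<in>fspan B. (\<lambda>x. f x + g x - h x) \<in> ell2 \<and> (\<Sum>\<^sub>\<infinity>x. (cmod (f x + g x - h x))\<^sup>2) < e"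
    using ell2_add[OF f(2) g(2)] f(3) g(3) fspan_add[OF g(1) f(1)]
    unfolding eq by (intro bexI[of _ "\<lambda>x. f' x + g' x"]) auto
qed

lemma ell2_closure_fspan_scale:
  assumes "f \<in> ell2_closure (fspan B)"
  shows "(\<lambda>x. c * f x) \<in> ell2_closure (fspan B)"
  unfolding ell2_closure_def mem_Collect_eq
proof (intro allI impI)
  fix e :: real assume "e > 0"
  let ?d = "e / ((cmod c)\<^sup>2 + 1)"
  have pos: "(cmod c)\<^sup>2 + 1 > 0" by (simp add: add_nonneg_pos)
  obtain f' where f: "f' \<in> fspan B" "(\<lambda>x. f x - f' x) \<in> ell2" "(\<Sum>\<^sub>\<infinity>x. (cmod (f x - f' x))\<^sup>2) < ?d"
    using ell2_closureD[OF assms, of ?d] \<open>e > 0\<close> pos by auto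
  have "(cmod c)\<^sup>2 * (\<Sum>\<^sub>\<infinity>x. (cmod (f x - f' x))\<^sup>2) \<le> (cmod c)\<^sup>2 * ?d"
    using f(3) by (intro mult_left_mono) auto
  also have "\<dots> < e" using pos \<open>e > 0\<close> by (simp add: field_simps)
  finally show "\<exists>h\<in>fspan B. (\<lambda>x. c * f x - h x) \<in> ell2 \<and> (\<Sum>\<^sub>\<infinity>x. (cmod (c * f x - h x))\<^sup>2) < e"
    using ell2_scale[OF f(2), of c] fspan_scale[OF f(1), of c]
    by (intro bexI[of _ "\<lambda>x. c * f' x"]) (auto simp: right_diff_distrib)
qed

text \<open>Linearity gives all finitely supported functions, truncation approximates an arbitrary
  one by these, and idempotence of the closure joins the two approximations.\<close>

lemma ell2_subset_closure_fspan:
  assumes "\<And>a. (\<lambda>x. if x = a then 1 else 0) \<in> ell2_closure (fspan B)"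
  shows "ell2 \<subseteq> ell2_closure (fspan B)"
proof
  fix f :: "'a \<Rightarrow> complex" assume f: "f \<in> ell2"
  have fin: "(\<lambda>x. if x \<in> A then f x else 0) \<in> ell2_closure (fspan B)" if "finite A" for A
    using that
  proof (induction A rule: finite_induct)
    case empty
    have "(\<lambda>x. 0) \<in> ell2_closure (fspan B)"
      unfolding ell2_closure_def by (auto intro!: bexI[of _ "\<lambda>x. 0"] fspan.zero ell2_finite_support)
    then show ?case by simp
  next
    case (insert a A)
    have "(\<lambda>x. if x \<in> insert a A then f x else 0)
        = (\<lambda>x. (if x \<in> A then f x else 0) + f a * (if x = a then 1 else 0))"
      using insert by auto
    then show ?case
      using ell2_closure_fspan_add[OF insert.IH ell2_closure_fspan_scale[OF assms, of "f a" a]] by simp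
  qed
  have "f \<in> ell2_closure (ell2_closure (fspan B))"
    unfolding ell2_closure_def[of "ell2_closure _"] mem_Collect_eq
  proof (intro allI impI)
    fix e :: real assume "e > 0"
    have s: "(\<lambda>x. (cmod (f x))\<^sup>2) summable_on UNIV" using f by (simp add: ell2_def)
    obtain A where A: "finite A" "dist (\<Sum>x\<in>A. (cmod (f x))\<^sup>2) (\<Sum>\<^sub>\<infinity>x. (cmod (f x))\<^sup>2) \<le> e / 2"
      using infsum_finite_approximation[OF s, of "e / 2"] \<open>e > 0\<close> by auto
    let ?g = "\<lambda>x. if x \<in> A then f x else 0"
    have *: "(\<lambda>x. (cmod (f x - ?g x))\<^sup>2) summable_on UNIV"
      by (rule summable_on_comparison_test[OF s]) auto
    have "(\<Sum>\<^sub>\<infinity>x. (cmod (f x))\<^sup>2) = (\<Sum>\<^sub>\<infinity>x. (cmod (f x - ?g x))\<^sup>2 + (cmod (?g x))\<^sup>2)"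
      by (intro infsum_cong) auto
    also have "\<dots> = (\<Sum>\<^sub>\<infinity>x. (cmod (f x - ?g x))\<^sup>2) + (\<Sum>\<^sub>\<infinity>x. (cmod (?g x))\<^sup>2)"
      by (intro infsum_add * finite_nonzero_values_imp_summable_on finite_subset[OF _ A(1)]) auto
    also have "(\<Sum>\<^sub>\<infinity>x. (cmod (?g x))\<^sup>2) = (\<Sum>x\<in>A. (cmod (f x))\<^sup>2)"
      by (subst infsum_finite_support[OF A(1)]) auto
    finally have "(\<Sum>\<^sub>\<infinity>x. (cmod (f x - ?g x))\<^sup>2) < e"
      using A(2) \<open>e > 0\<close> by (simp add: dist_real_def)
    then show "\<exists>g\<in>ell2_closure (fspan B). (\<lambda>x. f x - g x) \<in> ell2 \<and> (\<Sum>\<^sub>\<infinity>x. (cmod (f x - g x))\<^sup>2) < e"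
      using * fin[OF A(1)] by (intro bexI[of _ ?g]) (auto simp: ell2_def)
  qed
  then show "f \<in> ell2_closure (fspan B)" using ell2_closure_idem by blast
qed

lemma ell2_orthonormal_basisI:
  assumes "ell2_orthonormal B" "\<And>a. (\<lambda>x. if x = a then 1 else 0) \<in> ell2_closure (fspan B)"
  shows "ell2_orthonormal_basis B"
  unfolding ell2_orthonormal_basis_def
proof (intro conjI ballI allI impI)
  fix f :: "'a \<Rightarrow> complex" and e :: real assume "f \<in> ell2" "e > 0"
  then have "f \<in> ell2_closure (fspan B)" using ell2_subset_closure_fspan[OF assms(2)] by blast
  then obtain g where g: "g \<in> fspan B" "(\<Sum>\<^sub>\<infinity>x. (cmod (f x - g x))\<^sup>2) < e\<^sup>2"
    using ell2_closureD[of f _ "e\<^sup>2"] \<open>e > 0\<close> by auto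
  obtain F k where F: "finite F" "F \<subseteq> B" "g = (\<lambda>x. \<Sum>u\<in>F. k u * u x)"
    using fspan_imp_sum[OF g(1)] by blast
  have "ell2_norm (\<lambda>x. f x - (\<Sum>u\<in>F. k u * u x)) < e"
    unfolding ell2_norm_def using g(2) \<open>e > 0\<close> by (intro real_less_lsqrt) (auto simp: F(3))
  then show "\<exists>F k. finite F \<and> F \<subseteq> B \<and> ell2_norm (\<lambda>x. f x - (\<Sum>u\<in>F. k u * u x)) < e"
    using F by blast
qed (rule assms(1))

text \<open>If \<open>v a\<close> were nonzero, some \<open>g\<close> in the span would be closer to
  \<open>v\<close> than \<open>cmod (v a)\<close>. Orthogonality gives squared distance
  \<open>|v|^2 + |g|^2\<close>, which is at least \<open>(cmod (v a))^2\<close>. Finite supports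
  make the inner products finite sums.\<close>

lemma ell2_orthogonal_basis_eq_0:
  assumes B: "ell2_orthonormal_basis B" and fin: "\<And>u. u \<in> B \<Longrightarrow> finite {x. u x \<noteq> 0}"
    and v: "v \<in> ell2" and orth: "\<And>u. u \<in> B \<Longrightarrow> ell2_inner v u = 0"
  shows "v = (\<lambda>x. 0)"
proof (rule ccontr)
  assume "v \<noteq> (\<lambda>x. 0)"
  then obtain a where a: "v a \<noteq> 0" by auto
  have s: "(\<lambda>x. (cmod (v x))\<^sup>2) summable_on UNIV" using v by (simp add: ell2_def)
  have "(cmod (v a))\<^sup>2 = (\<Sum>\<^sub>\<infinity>x\<in>{a}. (cmod (v x))\<^sup>2)" by simp
  also have "\<dots> \<le> (\<Sum>\<^sub>\<infinity>x. (cmod (v x))\<^sup>2)" by (rule infsum_mono2[OF _ s]) auto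
  finally have pos: "(cmod (v a))\<^sup>2 \<le> (\<Sum>\<^sub>\<infinity>x. (cmod (v x))\<^sup>2)" .
  obtain F k where F: "finite F" "F \<subseteq> B" "ell2_norm (\<lambda>x. v x - (\<Sum>u\<in>F. k u * u x)) < cmod (v a)"
    using conjunct2[OF B[unfolded ell2_orthonormal_basis_def], rule_format, OF v, of "cmod (v a)"] a
    by auto
  define g where "g = (\<lambda>x. \<Sum>u\<in>F. k u * u x)"
  have "{x. g x \<noteq> 0} \<subseteq> (\<Union>u\<in>F. {x. u x \<noteq> 0})"
    unfolding g_def by (auto dest: sum.not_neutral_contains_not_neutral)
  then have fg: "finite {x. g x \<noteq> 0}" 
    by (rule finite_subset) (use F fin in auto)
  have "(\<Sum>\<^sub>\<infinity>x. v x * cnj (g x)) = (\<Sum>x | g x \<noteq> 0. v x * cnj (g x))"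
    by (rule infsum_finite_support[OF fg]) auto
  have vu: "(\<lambda>x. v x * cnj (u x)) summable_on UNIV" if "u \<in> F" for u
    by (rule finite_nonzero_values_imp_summable_on, rule finite_subset[OF _ fin[of u]]) (use that F in auto)
  have "((\<lambda>x. \<Sum>u\<in>F. cnj (k u) * (v x * cnj (u x))) has_sum (\<Sum>u\<in>F. cnj (k u) * (\<Sum>\<^sub>\<infinity>x. v x * cnj (u x)))) UNIV"
    by (intro has_sum_sum has_sum_cmult_right has_sum_infsum vu)
  also have "(\<Sum>u\<in>F. cnj (k u) * (\<Sum>\<^sub>\<infinity>x. v x * cnj (u x))) = 0"
    using orth F by (intro sum.neutral) (auto simp: ell2_inner_def)
  also have "(\<lambda>x. \<Sum>u\<in>F. cnj (k u) * (v x * cnj (u x))) = (\<lambda>x. v x * cnj (g x))"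
    by (simp add: g_def sum_distrib_left mult_ac)
  finally have "((\<lambda>x. Re (v x * cnj (g x))) has_sum Re 0) UNIV" by (rule has_sum_Re)
  then have cross: "((\<lambda>x. - 2 * Re (v x * cnj (g x))) has_sum - 2 * 0) UNIV"
    by (intro has_sum_cmult_right) simp
  have sg: "((\<lambda>x. (cmod (g x))\<^sup>2) has_sum (\<Sum>\<^sub>\<infinity>x. (cmod (g x))\<^sup>2)) UNIV"
    by (intro has_sum_infsum finite_nonzero_values_imp_summable_on) (use fg in auto)
  have "((\<lambda>x. (cmod (v x))\<^sup>2 + (cmod (g x))\<^sup>2 + - 2 * Re (v x * cnj (g x))) has_sum
      (\<Sum>\<^sub>\<infinity>x. (cmod (v x))\<^sup>2) + (\<Sum>\<^sub>\<infinity>x. (cmod (g x))\<^sup>2) + - 2 * 0) UNIV"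
    by (intro has_sum_add has_sum_infsum[OF s] sg cross)
  also have "(\<lambda>x. (cmod (v x))\<^sup>2 + (cmod (g x))\<^sup>2 + - 2 * Re (v x * cnj (g x))) = (\<lambda>x. (cmod (v x - g x))\<^sup>2)"
    by (simp add: fun_eq_iff cmod_power2 power2_diff algebra_simps)
  finally have "(\<Sum>\<^sub>\<infinity>x. (cmod (v x - g x))\<^sup>2) = (\<Sum>\<^sub>\<infinity>x. (cmod (v x))\<^sup>2) + (\<Sum>\<^sub>\<infinity>x. (cmod (g x))\<^sup>2)"
    by (simp add: infsumI)
  moreover have "(\<Sum>\<^sub>\<infinity>x. (cmod (g x))\<^sup>2) \<ge> 0" by (intro infsum_nonneg) auto
  moreover have "(\<Sum>\<^sub>\<infinity>x. (cmod (v x - g x))\<^sup>2) < (cmod (v a))\<^sup>2"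
  proof -
    have "sqrt (\<Sum>\<^sub>\<infinity>x. (cmod (v x - g x))\<^sup>2) < cmod (v a)"
      using F(3) by (simp add: ell2_norm_def g_def)
    then have "sqrt (\<Sum>\<^sub>\<infinity>x. (cmod (v x - g x))\<^sup>2) < sqrt ((cmod (v a))\<^sup>2)" by simp
    then show ?thesis by (simp only: real_sqrt_less_iff)
  qed
  ultimately show False using pos by linarith
qed

section \<open>Transport of the point spectrum along an involution of the index set\<close>

lemma ell2_reindex:
  assumes "bij \<phi>"
  shows "(\<lambda>x. f (\<phi> x)) \<in> ell2 \<longleftrightarrow> f \<in> ell2"
    and "ell2_inner (\<lambda>x. f (\<phi> x)) (\<lambda>x. g (\<phi> x)) = ell2_inner f g"
    and "ell2_norm (\<lambda>x. f (\<phi> x)) = ell2_norm f"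
proof -
  have b: "bij_betw \<phi> UNIV UNIV" using assms by simp
  show "(\<lambda>x. f (\<phi> x)) \<in> ell2 \<longleftrightarrow> f \<in> ell2"
    unfolding ell2_def using summable_on_reindex_bij_betw[OF b, of "\<lambda>x. (cmod (f x))\<^sup>2"] by simp
  show "ell2_inner (\<lambda>x. f (\<phi> x)) (\<lambda>x. g (\<phi> x)) = ell2_inner f g"
    unfolding ell2_inner_def using infsum_reindex_bij_betw[OF b, of "\<lambda>x. f x * cnj (g x)"] by simp
  show "ell2_norm (\<lambda>x. f (\<phi> x)) = ell2_norm f"
    unfolding ell2_norm_def using infsum_reindex_bij_betw[OF b, of "\<lambda>x. (cmod (f x))\<^sup>2"] by simp
qed

text \<open>Here \<open>T\<close> is the conjugate of \<open>S\<close> by the unitary involution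
  that composes with \<open>\<phi>\<close>. It is applied below with inversion in the group.\<close>

context
  fixes \<phi> :: "'a \<Rightarrow> 'a" and S T :: "('a \<Rightarrow> complex) \<Rightarrow> ('a \<Rightarrow> complex)"
  assumes inv: "\<And>x. \<phi> (\<phi> x) = x"
    and conj: "\<And>g. T (\<lambda>x. g (\<phi> x)) = (\<lambda>x. S g (\<phi> x))"
begin

lemma bij_involution: "bij \<phi>"
  by (rule involuntory_imp_bij) (rule inv)

lemma eigenvector_conjugate: "eigenvector T z (\<lambda>x. v (\<phi> x)) \<longleftrightarrow> eigenvector S z v"
proof -
  have "(\<lambda>x. f (\<phi> x)) = (\<lambda>x. g (\<phi> x)) \<longleftrightarrow> f = g" for f g :: "'a \<Rightarrow> complex"
  proof
    assume eq: "(\<lambda>x. f (\<phi> x)) = (\<lambda>x. g (\<phi> x))"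
    show "f = g"
    proof
      fix x show "f x = g x" using fun_cong[OF eq, of "\<phi> x"] by (simp add: inv)
    qed
  qed simp
  from this[of v "\<lambda>x. 0"] this[of "S v" "\<lambda>x. z * v x"] show ?thesis
    unfolding eigenvector_def conj ell2_reindex(1)[OF bij_involution] by simp
qed

lemma eigenvalues_conjugate: "eigenvalues T = eigenvalues S"
proof -
  have "eigenvector T z w \<longleftrightarrow> eigenvector S z (\<lambda>x. w (\<phi> x))" for z w
    using eigenvector_conjugate[of z "\<lambda>x. w (\<phi> x)"] by (simp add: inv)
  then show ?thesis unfolding eigenvalues_def using eigenvector_conjugate by blast
qed

lemma pure_point_spectrum_conjugate:
  assumes "pure_point_spectrum S"
  shows "pure_point_spectrum T"
proof -
  from assms obtain B where B: "ell2_orthonormal_basis B" "\<forall>v\<in>B. \<exists>z. eigenvector S z v"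
    by (auto simp: pure_point_spectrum_def)
  let ?c = "\<lambda>v x. v (\<phi> x) :: complex"
  have cc: "?c (?c v) = v" for v by (simp add: inv)
  have inj: "inj ?c"
    by (rule inj_on_inverseI[where g = ?c]) (rule cc)
  have on: "ell2_orthonormal (?c ` B)"
    using B(1) unfolding ell2_orthonormal_basis_def ell2_orthonormal_def
    by (auto simp: ell2_reindex[OF bij_involution] inj_eq[OF inj])
  have dense: "\<exists>F k. finite F \<and> F \<subseteq> ?c ` B \<and> ell2_norm (\<lambda>x. f x - (\<Sum>u\<in>F. k u * u x)) < e"
    if f: "f \<in> ell2" and e: "e > 0" for f e
  proof -
    have "?c f \<in> ell2" using f by (simp add: ell2_reindex[OF bij_involution])
    then obtain F k where F: "finite F" "F \<subseteq> B" "ell2_norm (\<lambda>x. ?c f x - (\<Sum>u\<in>F. k u * u x)) < e"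
      using B(1) e unfolding ell2_orthonormal_basis_def by meson
    have "(\<lambda>x. f x - (\<Sum>u\<in>?c ` F. k (?c u) * u x)) = (\<lambda>x. ?c f (\<phi> x) - (\<Sum>u\<in>F. k u * u (\<phi> x)))"
      by (subst sum.reindex) (auto simp: inv intro: inj_on_subset[OF inj])
    then have "ell2_norm (\<lambda>x. f x - (\<Sum>u\<in>?c ` F. k (?c u) * u x)) < e"
      using F(3) ell2_reindex(3)[OF bij_involution, of "\<lambda>x. ?c f x - (\<Sum>u\<in>F. k u * u x)"] by simp
    then show ?thesis using F by (intro exI[of _ "?c ` F"] exI[of _ "\<lambda>u. k (?c u)"]) auto
  qed
  have "\<forall>v\<in>?c ` B. \<exists>z. eigenvector T z v" using B(2) eigenvector_conjugate by auto
  then show ?thesis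
    unfolding pure_point_spectrum_def ell2_orthonormal_basis_def using on dense by blast
qed

end

section \<open>The convolution operator in lamp coordinates\<close>

text \<open>In the coordinates \<open>(h, k)\<close> of the inverse, left translations become local moves: a step between
  \<open>k - 1\<close> and \<open>k\<close> can only affect the lamp \<open>k\<close>, which thus labels that edge.\<close>

definition toggle :: "int \<Rightarrow> (int \<Rightarrow>\<^sub>0 bit) \<Rightarrow> (int \<Rightarrow>\<^sub>0 bit)" where
  "toggle j h = h + Poly_Mapping.single j 1"

text \<open>The terms come from right multiplication of \<open>(h, k)\<close> by \<open>a\<close>,
  \<open>b\<close>, the inverses of \<open>a\<close> and \<open>b\<close>, and \<open>c\<close>, in
  this order.\<close>

definition walk_op :: "real \<Rightarrow> (lamplighter \<Rightarrow> complex) \<Rightarrow> (lamplighter \<Rightarrow> complex)" where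
  "walk_op \<mu> G = (\<lambda>(h, k). G (h, k + 1) + G (toggle (k + 1) h, k + 1)
     + G (h, k - 1) + G (toggle k h, k - 1) - of_real \<mu> * G (toggle k h, k))"

lemma lookup_toggle: "Poly_Mapping.lookup (toggle j h) i =
    (if i = j then Poly_Mapping.lookup h i + 1 else Poly_Mapping.lookup h i)"
  by (auto simp: toggle_def lookup_add lookup_single)

lemma toggle_toggle [simp]: "toggle j (toggle j h) = h"
  by (simp add: toggle_def add.assoc)

lemma shift_single: "shift n (Poly_Mapping.single j x) = Poly_Mapping.single (j + n) x"
  by (rule poly_mapping_eqI) (auto simp: lookup_shift lookup_single when_def)

lemma M_op_eq:
  "M_op \<mu> F x = F (inv\<^bsub>\<L>\<^esub> gen_a \<otimes>\<^bsub>\<L>\<^esub> x) + F (gen_a \<otimes>\<^bsub>\<L>\<^esub> x)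
     + F (inv\<^bsub>\<L>\<^esub> gen_b \<otimes>\<^bsub>\<L>\<^esub> x) + F (gen_b \<otimes>\<^bsub>\<L>\<^esub> x)
     - of_real \<mu> * F (gen_c \<otimes>\<^bsub>\<L>\<^esub> x)"
proof -
  note defs = gen_a_def gen_b_def gen_c_def mult_lamplighter inv_lamplighter shift_single
  have ne: "Poly_Mapping.single i (1 :: bit) \<noteq> 0" "0 \<noteq> Poly_Mapping.single i (1 :: bit)" for i :: int
    by (metis lookup_single_eq lookup_zero one_neq_zero)+
  let ?S = "{gen_a, inv\<^bsub>\<L>\<^esub> gen_a, gen_b, inv\<^bsub>\<L>\<^esub> gen_b, gen_c}"
  have dist: "gen_a \<noteq> inv\<^bsub>\<L>\<^esub> gen_a" "gen_a \<noteq> gen_b" "gen_a \<noteq> inv\<^bsub>\<L>\<^esub> gen_b" "gen_a \<noteq> gen_c"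
    "inv\<^bsub>\<L>\<^esub> gen_a \<noteq> gen_b" "inv\<^bsub>\<L>\<^esub> gen_a \<noteq> inv\<^bsub>\<L>\<^esub> gen_b" "inv\<^bsub>\<L>\<^esub> gen_a \<noteq> gen_c"
    "gen_b \<noteq> inv\<^bsub>\<L>\<^esub> gen_b" "gen_b \<noteq> gen_c" "inv\<^bsub>\<L>\<^esub> gen_b \<noteq> gen_c"
    using ne by (simp_all add: defs del: single_one)
  have coef: "Poly_Mapping.lookup (m_elem \<mu>) g = (if g = gen_a then 1 else 0)
      + (if g = inv\<^bsub>\<L>\<^esub> gen_a then 1 else 0) + (if g = gen_b then 1 else 0)
      + (if g = inv\<^bsub>\<L>\<^esub> gen_b then 1 else 0) - (if g = gen_c then \<mu> else 0)" for g
    by (simp add: m_elem_def lookup_add lookup_minus lookup_single when_def eq_commute[of g])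
  have "M_op \<mu> F x = (\<Sum>g\<in>?S. of_real (Poly_Mapping.lookup (m_elem \<mu>) g) * F (inv\<^bsub>\<L>\<^esub> g \<otimes>\<^bsub>\<L>\<^esub> x))"
    unfolding M_op_def conv_op_def
  \<comment> \<open>For \<open>\<mu> = 0\<close> the element \<open>gen_c\<close> drops out of the
    support, so the sum is extended to five fixed elements.\<close>
  proof (rule sum.mono_neutral_left)
    show "Poly_Mapping.keys (m_elem \<mu>) \<subseteq> ?S"
    proof
      fix g assume "g \<in> Poly_Mapping.keys (m_elem \<mu>)"
      then have "Poly_Mapping.lookup (m_elem \<mu>) g \<noteq> 0" by (simp add: in_keys_iff)
      then show "g \<in> ?S" unfolding coef by (auto split: if_splits)
    qed
  qed (auto simp: in_keys_iff)
  moreover have "inv\<^bsub>\<L>\<^esub> (inv\<^bsub>\<L>\<^esub> g) = g" for g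
    using group.inv_inv[OF group_lamplighter] by simp
  moreover have "inv\<^bsub>\<L>\<^esub> gen_c = gen_c"
    by (simp add: defs del: single_one)
  ultimately show ?thesis
    using dist dist[symmetric] by (simp add: coef)
qed

text \<open>Inversion turns left translation by the inverse of a group element into right
  multiplication by that element.\<close>

lemma M_op_conjugate: "M_op \<mu> (\<lambda>x. G (inv\<^bsub>\<L>\<^esub> x)) = (\<lambda>x. walk_op \<mu> G (inv\<^bsub>\<L>\<^esub> x))"
proof
  fix x :: lamplighter
  obtain f n where x: "x = (f, n)" by (cases x)
  have *: "- n - 1 = - 1 - n" by simp
  show "M_op \<mu> (\<lambda>x. G (inv\<^bsub>\<L>\<^esub> x)) x = walk_op \<mu> G (inv\<^bsub>\<L>\<^esub> x)"
    by (simp add: x M_op_eq walk_op_def gen_a_def gen_b_def gen_c_def mult_lamplighter inv_lamplighter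
        shift_single shift_add shift_shift toggle_def algebra_simps * del: single_one)
qed

lemma inv_inv_lamplighter: "inv\<^bsub>\<L>\<^esub> (inv\<^bsub>\<L>\<^esub> x) = x"
  using group.inv_inv[OF group_lamplighter] by simp

text \<open>The moves \<open>R\<close>, \<open>R'\<close> and \<open>S\<close>, \<open>S'\<close>
  are mutually inverse pairs and \<open>C\<close> is an involution, so reindexing moves each term
  from \<open>v\<close> to \<open>u\<close>. Finite support of \<open>u\<close> provides all
  summability, with no condition on \<open>v\<close>.\<close>

lemma walk_op_symmetric:
  assumes u: "finite {y. u y \<noteq> 0}"
  shows "(\<Sum>\<^sub>\<infinity>y. walk_op \<mu> v y * u y) = (\<Sum>\<^sub>\<infinity>y. v y * walk_op \<mu> u y)"
proof -
  define R where "R = (\<lambda>(h::int \<Rightarrow>\<^sub>0 bit, k::int). (h, k + 1))"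
  define R' where "R' = (\<lambda>(h::int \<Rightarrow>\<^sub>0 bit, k::int). (h, k - 1))"
  define S where "S = (\<lambda>(h::int \<Rightarrow>\<^sub>0 bit, k::int). (toggle (k + 1) h, k + 1))"
  define S' where "S' = (\<lambda>(h::int \<Rightarrow>\<^sub>0 bit, k::int). (toggle k h, k - 1))"
  define C where "C = (\<lambda>(h::int \<Rightarrow>\<^sub>0 bit, k::int). (toggle k h, k))"
  have w: "walk_op \<mu> g y = g (R y) + g (S y) + g (R' y) + g (S' y) + (- of_real \<mu>) * g (C y)" for g y
    by (cases y) (simp add: walk_op_def R_def S_def R'_def S'_def C_def)
  have inv: "R (R' y) = y" "R' (R y) = y" "S (S' y) = y" "S' (S y) = y" "C (C y) = y" for y
    by (cases y; simp add: R_def S_def R'_def S'_def C_def)+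
  have fin: "(\<lambda>y. c * (a y * u y)) summable_on UNIV" for a :: "lamplighter \<Rightarrow> complex" and c
    by (rule finite_nonzero_values_imp_summable_on, rule finite_subset[OF _ u]) auto
  have bij: "bij_betw \<alpha> UNIV UNIV" if "\<And>y. \<alpha> (\<beta> y) = y" "\<And>y. \<beta> (\<alpha> y) = y"
    for \<alpha> \<beta> :: "lamplighter \<Rightarrow> lamplighter"
    using that by (intro bij_betwI[where g = \<beta>]) auto
  have move: "((\<lambda>y. c * (v y * u (\<beta> y))) has_sum (\<Sum>\<^sub>\<infinity>y. c * (v (\<alpha> y) * u y))) UNIV"
    if "\<And>y. \<alpha> (\<beta> y) = y" "\<And>y. \<beta> (\<alpha> y) = y" for \<alpha> \<beta> c
  proof -
    have "((\<lambda>y. c * (v (\<alpha> y) * u (\<beta> (\<alpha> y)))) has_sum (\<Sum>\<^sub>\<infinity>y. c * (v (\<alpha> y) * u y))) UNIV"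
      using has_sum_infsum[OF fin[of c "\<lambda>y. v (\<alpha> y)"]] by (simp add: that)
    then show ?thesis
      using has_sum_reindex_bij_betw[OF bij[OF that], of "\<lambda>y. c * (v y * u (\<beta> y))"] by simp
  qed
  have "((\<lambda>y. 1 * (v (R y) * u y) + 1 * (v (S y) * u y) + 1 * (v (R' y) * u y) + 1 * (v (S' y) * u y)
       + (- of_real \<mu>) * (v (C y) * u y)) has_sum
     (\<Sum>\<^sub>\<infinity>y. 1 * (v (R y) * u y)) + (\<Sum>\<^sub>\<infinity>y. 1 * (v (S y) * u y)) + (\<Sum>\<^sub>\<infinity>y. 1 * (v (R' y) * u y))
       + (\<Sum>\<^sub>\<infinity>y. 1 * (v (S' y) * u y)) + (\<Sum>\<^sub>\<infinity>y. (- of_real \<mu>) * (v (C y) * u y))) UNIV"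
    (is "(_ has_sum ?s) _")
    by (intro has_sum_add has_sum_infsum fin)
  then have l: "((\<lambda>y. walk_op \<mu> v y * u y) has_sum ?s) UNIV"
    by (rule has_sum_cong[THEN iffD1, rotated]) (simp add: w algebra_simps)
  have "((\<lambda>y. 1 * (v y * u (R' y)) + 1 * (v y * u (S' y)) + 1 * (v y * u (R y)) + 1 * (v y * u (S y))
       + (- of_real \<mu>) * (v y * u (C y))) has_sum ?s) UNIV"
    by (intro has_sum_add move) (simp_all add: inv)
  then have r: "((\<lambda>y. v y * walk_op \<mu> u y) has_sum ?s) UNIV"
    by (rule has_sum_cong[THEN iffD1, rotated]) (simp add: w algebra_simps)
  show ?thesis using infsumI[OF l] infsumI[OF r] by simp
qed

section \<open>The eigenbasis\<close>

text \<open>The character of the lamp group that reads the lamp \<open>j\<close>.\<close>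

definition lamp_sign :: "int \<Rightarrow> (int \<Rightarrow>\<^sub>0 bit) \<Rightarrow> real" where
  "lamp_sign j h = (if Poly_Mapping.lookup h j = 0 then 1 else - 1)"

text \<open>The coset of \<open>h0\<close> modulo the configurations supported in
  \<open>W\<close>.\<close>

definition agree_off :: "int set \<Rightarrow> (int \<Rightarrow>\<^sub>0 bit) \<Rightarrow> (int \<Rightarrow>\<^sub>0 bit) set" where
  "agree_off W h0 = {h. \<forall>j. j \<notin> W \<longrightarrow> Poly_Mapping.lookup h j = Poly_Mapping.lookup h0 j}"

text \<open>On the window \<open>{p..p + n}\<close> the Fourier transform of the following function is supported on
  the single character that is \<open>-1\<close> at both ends and \<open>1\<close> in between.\<close>

definition window_char :: "int \<Rightarrow> nat \<Rightarrow> (int \<Rightarrow>\<^sub>0 bit) \<Rightarrow> (int \<Rightarrow>\<^sub>0 bit) \<Rightarrow> real" where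
  "window_char p n h0 h =
     (if h \<in> agree_off {p..p + int n} h0 then lamp_sign p h * lamp_sign (p + int n) h / sqrt (2 ^ Suc n) else 0)"

text \<open>The \<open>n\<close> sites have \<open>n + 1\<close> adjacent edges, hence a window with
  one more lamp than sites. The potential is \<open>\<mu>\<close> at the first site and
  \<open>-\<mu>\<close> at the others, and the inner edges have weight 2; together this is
  \<open>2 J_n - \<mu>\<close>.\<close>

definition eig_fun :: "real \<Rightarrow> int \<Rightarrow> nat \<Rightarrow> real \<Rightarrow> (int \<Rightarrow>\<^sub>0 bit) \<Rightarrow> lamplighter \<Rightarrow> real" where
  "eig_fun \<mu> p n x h0 = (\<lambda>(h, k).
     (if k \<in> {p..<p + int n} then jvec \<mu> n x (nat (k - p)) else 0) * window_char p n h0 h)"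

lemma bit_flip: "(a :: bit) + 1 = 0 \<longleftrightarrow> a \<noteq> 0"
  by (cases a) auto

lemma lamp_sign_toggle: "lamp_sign i (toggle j h) = (if i = j then - 1 else 1) * lamp_sign i h"
  by (auto simp: lamp_sign_def lookup_toggle bit_flip)

lemma agree_off_toggle: "j \<in> W \<Longrightarrow> toggle j h \<in> agree_off W h0 \<longleftrightarrow> h \<in> agree_off W h0"
  unfolding agree_off_def lookup_toggle mem_Collect_eq by metis

lemma agree_off_cong: "h \<in> agree_off W h0 \<Longrightarrow> agree_off W h = agree_off W h0"
  by (auto simp: agree_off_def)

lemma agree_off_card:
  assumes "finite W"
  shows "finite (agree_off W h) \<and> card (agree_off W h) = 2 ^ card W"
  using assms
proof (induction W rule: finite_induct)
  case empty
  have "agree_off {} h = {h}" by (auto simp: agree_off_def intro: poly_mapping_eqI)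
  then show ?case by simp
next
  case (insert j W)
  have "agree_off (insert j W) h = agree_off W h \<union> toggle j ` agree_off W h"
  proof (intro equalityI subsetI)
    fix g assume g: "g \<in> agree_off (insert j W) h"
    show "g \<in> agree_off W h \<union> toggle j ` agree_off W h"
    proof (cases "Poly_Mapping.lookup g j = Poly_Mapping.lookup h j")
      case True
      then show ?thesis using g by (auto simp: agree_off_def)
    next
      case False
      then have "Poly_Mapping.lookup g j + 1 = Poly_Mapping.lookup h j"
        by (cases "Poly_Mapping.lookup g j"; cases "Poly_Mapping.lookup h j") auto
      then have "toggle j g \<in> agree_off W h" using g by (auto simp: agree_off_def lookup_toggle)
      then show ?thesis by (metis UnCI image_eqI toggle_toggle)
    qed
  next
    fix g assume "g \<in> agree_off W h \<union> toggle j ` agree_off W h"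
    then show "g \<in> agree_off (insert j W) h"
      by (auto simp: agree_off_def lookup_toggle)
  qed
  moreover have "agree_off W h \<inter> toggle j ` agree_off W h = {}"
  proof (intro equals0I)
    fix g assume "g \<in> agree_off W h \<inter> toggle j ` agree_off W h"
    then obtain g' where g: "g = toggle j g'" "g \<in> agree_off W h" "g' \<in> agree_off W h" by blast
    have "Poly_Mapping.lookup g j = Poly_Mapping.lookup g' j"
      using insert.hyps(2) g(2,3) by (simp add: agree_off_def)
    then show False by (cases "Poly_Mapping.lookup g' j") (simp_all add: g(1) lookup_toggle)
  qed
  moreover have "inj_on (toggle j) (agree_off W h)"
    by (rule inj_on_inverseI[of _ "toggle j"]) simp
  ultimately show ?case
    using insert by (simp add: card_Un_disjoint card_image)
qed

text \<open>For \<open>n > 0\<close> the two end lamps are different, so flipping one of them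
  changes exactly one sign factor.\<close>

lemma window_char_toggle:
  assumes "j \<in> {p..p + int n}" "n > 0"
  shows "window_char p n h0 (toggle j h) = (if j = p \<or> j = p + int n then - 1 else 1) * window_char p n h0 h"
  using assms by (auto simp: window_char_def agree_off_toggle lamp_sign_toggle)

lemma window_char_sq: "(window_char p n h0 h)\<^sup>2 = (if h \<in> agree_off {p..p + int n} h0 then 1 / 2 ^ Suc n else 0)"
  by (auto simp: window_char_def lamp_sign_def power_divide)

lemma window_char_norm:
  "(\<Sum>h\<in>agree_off {p..p + int n} h0. (window_char p n h0 h)\<^sup>2) = 1"
proof -
  have c: "card {p..p + int n} = Suc n" by simp
  have "(\<Sum>h\<in>agree_off {p..p + int n} h0. (window_char p n h0 h)\<^sup>2) = (\<Sum>h\<in>agree_off {p..p + int n} h0. 1 / 2 ^ Suc n)"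
    by (intro sum.cong) (auto simp: window_char_sq)
  moreover have "card (agree_off {p..p + int n} h0) = 2 ^ Suc n"
    using agree_off_card[of "{p..p + int n}" h0] unfolding c by simp
  ultimately show ?thesis by simp
qed

section \<open>Orthogonality of the window eigenfunctions\<close>

lemma eig_fun_toggle:
  assumes "j \<in> {p..p + int n}" "n > 0"
  shows "eig_fun \<mu> p n x h0 (toggle j h, k) = (if j = p \<or> j = p + int n then - 1 else 1) * eig_fun \<mu> p n x h0 (h, k)"
  using window_char_toggle[OF assms] by (simp add: eig_fun_def)

lemma eig_fun_support:
  "eig_fun \<mu> p n x h0 y \<noteq> 0 \<Longrightarrow> y \<in> agree_off {p..p + int n} h0 \<times> {p..<p + int n}"
  by (cases y) (auto simp: eig_fun_def window_char_def split: if_splits)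

lemma finite_eig_fun_support: "finite {y. eig_fun \<mu> p n x h0 y \<noteq> 0}"
  by (rule finite_subset[of _ "agree_off {p..p + int n} h0 \<times> {p..<p + int n}"])
    (use eig_fun_support agree_off_card in \<open>blast, simp\<close>)

text \<open>If the windows share sites, some lamp lies in both and is an end of exactly one.
  Toggling it permutes the group and negates the product, so the sum equals its own
  negative.\<close>

lemma eig_fun_orthogonal_aux:
  assumes n: "n > 0" "n' > 0" and less: "p < p' \<or> p = p' \<and> n < n'"
  shows "(\<Sum>\<^sub>\<infinity>y. eig_fun \<mu> p n x h0 y * eig_fun \<mu> p' n' x' h0' y) = 0"
proof (cases "p + int n \<le> p'")
  case True
  have z: "eig_fun \<mu> p n x h0 y * eig_fun \<mu> p' n' x' h0' y = 0" for y
    by (cases y) (use True in \<open>auto simp: eig_fun_def\<close>)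
  show ?thesis by (simp add: z)
next
  case False
  \<comment> \<open>Either the left end of the second window, which is interior to the first, or,
    with equal left ends, the right end of the shorter window.\<close>
  define j where "j = (if p < p' then p' else p + int n)"
  define \<tau> where "\<tau> = (\<lambda>(h, k::int). (toggle j h, k))"
  let ?g = "\<lambda>y. eig_fun \<mu> p n x h0 y * eig_fun \<mu> p' n' x' h0' y"
  have j: "j \<in> {p..p + int n}" "j \<in> {p'..p' + int n'}"
    "(j = p \<or> j = p + int n) \<noteq> (j = p' \<or> j = p' + int n')"
    using less False n by (auto simp: j_def)
  have flip: "?g (\<tau> y) = - ?g y" for y
    using j(3) by (cases y) (auto simp: \<tau>_def eig_fun_toggle[OF j(1) n(1)] eig_fun_toggle[OF j(2) n(2)])
  have "\<tau> (\<tau> y) = y" for y by (cases y) (simp add: \<tau>_def)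
  then have "bij_betw \<tau> UNIV UNIV" by (intro bij_betwI[where g = \<tau>]) auto
  then have "(\<Sum>\<^sub>\<infinity>y. ?g y) = (\<Sum>\<^sub>\<infinity>y. ?g (\<tau> y))" by (rule infsum_reindex_bij_betw[symmetric])
  also have "\<dots> = - (\<Sum>\<^sub>\<infinity>y. ?g y)" unfolding flip by (rule infsum_uminus)
  finally show ?thesis by simp
qed

lemma eig_fun_orthogonal:
  assumes "n > 0" "n' > 0" "(p, n) \<noteq> (p', n')"
  shows "(\<Sum>\<^sub>\<infinity>y. eig_fun \<mu> p n x h0 y * eig_fun \<mu> p' n' x' h0' y) = 0"
proof -
  have "p < p' \<or> p = p' \<and> n < n' \<or> p' < p \<or> p' = p \<and> n' < n" using assms by auto
  then show ?thesis
    using eig_fun_orthogonal_aux[of n n' p p' \<mu> x h0 x' h0'] eig_fun_orthogonal_aux[of n' n p' p \<mu> x' h0' x h0] assms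
    by (auto simp: mult.commute)
qed

text \<open>Only the coset of the base configuration matters, so different parameters can name the
  same eigenfunction.\<close>

lemma eig_fun_cong: "h \<in> agree_off {p..p + int n} h0 \<Longrightarrow> eig_fun \<mu> p n x h = eig_fun \<mu> p n x h0"
  by (simp add: eig_fun_def window_char_def agree_off_cong)

lemma eig_fun_inner_same_window:
  assumes "jac \<mu> x n = 0" "jac \<mu> x' n = 0"
  shows "(\<Sum>\<^sub>\<infinity>y. eig_fun \<mu> p n x h0 y * eig_fun \<mu> p n x' h0 y) = (if x = x' then 1 else 0)"
proof -
  let ?A = "agree_off {p..p + int n} h0"
  have "(\<Sum>\<^sub>\<infinity>y. eig_fun \<mu> p n x h0 y * eig_fun \<mu> p n x' h0 y)
      = (\<Sum>y\<in>?A \<times> {p..<p + int n}. eig_fun \<mu> p n x h0 y * eig_fun \<mu> p n x' h0 y)"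
  proof (rule infsum_finite_support)
    show "finite (?A \<times> {p..<p + int n})" using agree_off_card by simp
    show "eig_fun \<mu> p n x h0 y * eig_fun \<mu> p n x' h0 y = 0" if "y \<notin> ?A \<times> {p..<p + int n}" for y
      using that eig_fun_support[of \<mu> p n x h0 y] by auto
  qed
  also have "\<dots> = (\<Sum>h\<in>?A. \<Sum>k\<in>{p..<p + int n}. eig_fun \<mu> p n x h0 (h, k) * eig_fun \<mu> p n x' h0 (h, k))"
    by (simp add: sum.cartesian_product case_prod_unfold)
  also have "\<dots> = (\<Sum>h\<in>?A. (window_char p n h0 h)\<^sup>2) *
      (\<Sum>k\<in>{p..<p + int n}. jvec \<mu> n x (nat (k - p)) * jvec \<mu> n x' (nat (k - p)))"
    unfolding sum_product by (intro sum.cong) (auto simp: eig_fun_def power2_eq_square)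
  also have "(\<Sum>k\<in>{p..<p + int n}. jvec \<mu> n x (nat (k - p)) * jvec \<mu> n x' (nat (k - p)))
      = (\<Sum>i<n. jvec \<mu> n x i * jvec \<mu> n x' i)"
    by (rule sum.reindex_bij_witness[of _ "\<lambda>i. p + int i" "\<lambda>k. nat (k - p)"]) auto
  finally show ?thesis using assms by (simp add: window_char_norm jvec_orthonormal)
qed

lemma eig_fun_inner:
  assumes "n > 0" "n' > 0" "jac \<mu> x n = 0" "jac \<mu> x' n' = 0"
  shows "(\<Sum>\<^sub>\<infinity>y. eig_fun \<mu> p n x h0 y * eig_fun \<mu> p' n' x' h0' y)
    = (if (p, n, x) = (p', n', x') \<and> h0' \<in> agree_off {p..p + int n} h0 then 1 else 0)"
proof (cases "(p, n) = (p', n') \<and> h0' \<in> agree_off {p..p + int n} h0")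
  case True
  then show ?thesis using eig_fun_inner_same_window[of \<mu> x n x' p h0] assms eig_fun_cong[of h0' p n h0 \<mu> x'] by auto
next
  case False
  show ?thesis
  proof (cases "(p, n) = (p', n')")
    case True
    with False have F: "h0' \<notin> agree_off {p..p + int n} h0" by simp
    have z: "eig_fun \<mu> p n x h0 y * eig_fun \<mu> p n x' h0' y = 0" for y
    proof (rule ccontr)
      assume "eig_fun \<mu> p n x h0 y * eig_fun \<mu> p n x' h0' y \<noteq> 0"
      then have "fst y \<in> agree_off {p..p + int n} h0" "fst y \<in> agree_off {p..p + int n} h0'"
        using eig_fun_support[of \<mu> p n x h0 y] eig_fun_support[of \<mu> p n x' h0' y] by auto
      then show False using F by (auto simp: agree_off_def)
    qed
    have "(\<Sum>\<^sub>\<infinity>y. eig_fun \<mu> p n x h0 y * eig_fun \<mu> p n x' h0' y) = 0"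
      unfolding z by simp
    then show ?thesis using True F by simp
  qed (use eig_fun_orthogonal[of n n' p p'] assms in auto)
qed

text \<open>A value and its toggled copy add up to twice the value at an inner lamp and cancel at an
  end lamp. The walk thus never leaves or enters the segment, and inside it the recurrence of
  \<open>jac\<close> remains.\<close>

lemma walk_op_eig_fun:
  assumes "n > 0" "jac \<mu> x n = 0"
  shows "walk_op \<mu> (\<lambda>y. of_real (eig_fun \<mu> p n x h0 y))
    = (\<lambda>y. of_real (2 * x - \<mu>) * of_real (eig_fun \<mu> p n x h0 y))"
proof
  fix y :: lamplighter
  obtain h k where y: "y = (h, k)" by (cases y)
  let ?u = "eig_fun \<mu> p n x h0" and ?w = "window_char p n h0 h"
  define a where "a = (\<lambda>i. jvec \<mu> n x i)"
  have an: "a n = 0" using assms by (simp add: a_def jvec_def)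
  \<comment> \<open>The extra diagonal entry of the first vertex; it matches the reversed sign of
    the potential term at \<open>k = p\<close>.\<close>
  have a0: "x * a 0 = \<mu> * a 0 + a 1"
    by (simp add: a_def jvec_def diff_divide_distrib)
  have aS: "x * a (Suc i) = a i + a (Suc (Suc i))" for i
    by (simp add: a_def jvec_def diff_divide_distrib)
  have right: "?u (h, k + 1) + ?u (toggle (k + 1) h, k + 1)
      = (if p \<le> k \<and> k + 1 < p + int n then 2 * a (nat (k + 1 - p)) * ?w else 0)"
  proof (cases "k + 1 \<in> {p..<p + int n}")
    case True
    then have t: "?u (toggle (k + 1) h, k + 1) = (if k + 1 = p then - 1 else 1) * ?u (h, k + 1)"
      by (subst eig_fun_toggle) (use assms in auto)
    show ?thesis using True unfolding t by (auto simp: eig_fun_def a_def)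
  qed (auto simp: eig_fun_def)
  have left: "?u (h, k - 1) + ?u (toggle k h, k - 1)
      = (if p < k \<and> k < p + int n then 2 * a (nat (k - 1 - p)) * ?w else 0)"
  proof (cases "k - 1 \<in> {p..<p + int n}")
    case True
    then have t: "?u (toggle k h, k - 1) = (if k = p + int n then - 1 else 1) * ?u (h, k - 1)"
      by (subst eig_fun_toggle) (use assms in auto)
    show ?thesis using True unfolding t by (auto simp: eig_fun_def a_def)
  qed (auto simp: eig_fun_def)
  have mid: "?u (toggle k h, k) = (if k = p then - 1 else 1) * ?u (h, k)"
  proof (cases "k \<in> {p..<p + int n}")
    case True
    then show ?thesis by (subst eig_fun_toggle) (use assms in auto)
  qed (auto simp: eig_fun_def)
  have "?u (h, k + 1) + ?u (toggle (k + 1) h, k + 1) + (?u (h, k - 1) + ?u (toggle k h, k - 1)) - \<mu> * ?u (toggle k h, k)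
      = (2 * x - \<mu>) * ?u (h, k)"
  proof (cases "k \<in> {p..<p + int n}")
    case False
    then show ?thesis unfolding right left mid by (auto simp: eig_fun_def)
  next
    case True
    then obtain i where i: "k = p + int i" "i < n"
      by (metis atLeastLessThan_iff add_less_cancel_left le_iff_add nonneg_int_cases of_nat_less_iff zle_iff_zadd)
    \<comment> \<open>At the last site the right neighbour is cut off, and \<open>a n = 0\<close>
      lets the truncated recurrence be read as the full one.\<close>
    have r: "(if p \<le> k \<and> k + 1 < p + int n then 2 * a (nat (k + 1 - p)) * ?w else 0) = 2 * a (Suc i) * ?w"
    proof (cases "Suc i = n")
      case True
      then show ?thesis using i an by auto
    next
      case False
      have "nat (k + 1 - p) = Suc i" using i by simp
      then show ?thesis using i False by auto
    qed
    have u: "?u (h, k) = a i * ?w" using i by (simp add: eig_fun_def a_def)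
    show ?thesis
    proof (cases i)
      case 0
      have "2 * a (Suc i) * ?w - \<mu> * (- 1 * (a i * ?w)) = (2 * a 1 + \<mu> * a 0) * ?w"
        by (simp add: 0 algebra_simps)
      also have "2 * a 1 + \<mu> * a 0 = (2 * x - \<mu>) * a 0" using a0 by (simp add: algebra_simps)
      finally show ?thesis unfolding right left mid r u using i 0 by simp
    next
      case (Suc l)
      have "nat (k - 1 - p) = l" using i Suc by simp
      moreover have "2 * a (Suc i) * ?w + 2 * a l * ?w - \<mu> * (a i * ?w) = (2 * (a l + a (Suc (Suc l))) - \<mu> * a i) * ?w"
        by (simp add: Suc algebra_simps)
      moreover have "2 * (a l + a (Suc (Suc l))) - \<mu> * a i = (2 * x - \<mu>) * a i"
        using aS[of l] Suc by (simp add: algebra_simps)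
      ultimately show ?thesis unfolding right left mid r u using i Suc by simp
    qed
  qed
  then have "complex_of_real (?u (h, k + 1) + ?u (toggle (k + 1) h, k + 1)
      + (?u (h, k - 1) + ?u (toggle k h, k - 1)) - \<mu> * ?u (toggle k h, k)) = of_real ((2 * x - \<mu>) * ?u (h, k))"
    by (simp only:)
  then show "walk_op \<mu> (\<lambda>y. of_real (?u y)) y = of_real (2 * x - \<mu>) * of_real (?u y)"
    by (simp add: y walk_op_def add.assoc)
qed

section \<open>Completeness of the eigenfunctions and the list of eigenvalues\<close>

definition eig_basis :: "real \<Rightarrow> (lamplighter \<Rightarrow> complex) set" where
  "eig_basis \<mu> = {\<lambda>y. of_real (eig_fun \<mu> p n x h y) | p n x h. n > 0 \<and> jac \<mu> x n = 0}"

lemma ell2_inner_eig_fun: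
  "ell2_inner (\<lambda>y. of_real (eig_fun \<mu> p n x h y)) (\<lambda>y. of_real (eig_fun \<mu> p' n' x' h' y))
    = of_real (\<Sum>\<^sub>\<infinity>y. eig_fun \<mu> p n x h y * eig_fun \<mu> p' n' x' h' y)"
proof -
  have "(\<lambda>y. eig_fun \<mu> p n x h y * eig_fun \<mu> p' n' x' h' y) summable_on UNIV"
    by (rule finite_nonzero_values_imp_summable_on, rule finite_subset[OF _ finite_eig_fun_support[of \<mu> p n x h]]) auto
  from infsumI[OF has_sum_of_real[OF has_sum_infsum[OF this]]] show ?thesis
    by (simp add: ell2_inner_def)
qed

lemma eig_basis_orthonormal: "ell2_orthonormal (eig_basis \<mu>)"
  unfolding ell2_orthonormal_def
proof (intro conjI ballI)
  show "eig_basis \<mu> \<subseteq> ell2"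
    unfolding eig_basis_def by (auto intro!: ell2_finite_support finite_eig_fun_support)
  fix u v assume "u \<in> eig_basis \<mu>" "v \<in> eig_basis \<mu>"
  then obtain p n x h p' n' x' h' where u: "u = (\<lambda>y. of_real (eig_fun \<mu> p n x h y))" "n > 0" "jac \<mu> x n = 0"
    and v: "v = (\<lambda>y. of_real (eig_fun \<mu> p' n' x' h' y))" "n' > 0" "jac \<mu> x' n' = 0"
    unfolding eig_basis_def by blast
  let ?c = "(p, n, x) = (p', n', x') \<and> h' \<in> agree_off {p..p + int n} h"
  have inner: "ell2_inner u v = of_real (\<Sum>\<^sub>\<infinity>y. eig_fun \<mu> p n x h y * eig_fun \<mu> p' n' x' h' y)"
    unfolding u(1) v(1) by (rule ell2_inner_eig_fun)
  then have i: "ell2_inner u v = (if ?c then 1 else 0)"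
    unfolding eig_fun_inner[OF u(2) v(2) u(3) v(3)]
    by (simp only: if_distrib[of of_real] of_real_1 of_real_0)
  show "ell2_inner u v = (if u = v then 1 else 0)"
  proof (cases ?c)
    case True
    then have "u = v" using eig_fun_cong[of h' p n h \<mu> x] by (auto simp: u(1) v(1))
    then show ?thesis using i True by simp
  next
    case False
    have i0: "ell2_inner u v = 0" by (rule trans[OF i if_not_P[OF False]])
    \<comment> \<open>Distinct parameters alone do not separate the functions; orthogonality
      together with unit norm does.\<close>
    have "u \<noteq> v"
    proof
      assume uv: "u = v"
      have "ell2_inner u u = of_real (\<Sum>\<^sub>\<infinity>y. eig_fun \<mu> p n x h y * eig_fun \<mu> p n x h y)"
        unfolding u(1) by (rule ell2_inner_eig_fun)
      then have "ell2_inner u u = 1" using eig_fun_inner_same_window[OF u(3) u(3), of p h] by simp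
      then show False using i0 uv by simp
    qed
    then show ?thesis using i0 by simp
  qed
qed

lemma sum_window_weights: "(\<Sum>n=1..N. real n / 2 ^ Suc n) = 1 - (real N + 2) / 2 ^ Suc N"
  by (induction N) (auto simp: field_simps)

text \<open>The windows through \<open>k\<close> with \<open>n\<close> sites each carry total weight \<open>1 / 2 ^ (n + 1)\<close> at \<open>(h, k)\<close>,
  and there are \<open>n\<close> of them; the weights sum to \<open>1\<close>.\<close>

lemma delta_in_closure_eig_basis: "(\<lambda>y. if y = a then 1 else 0) \<in> ell2_closure (fspan (eig_basis \<mu>))"
  unfolding ell2_closure_def mem_Collect_eq
proof (intro allI impI)
  fix e :: real assume "e > 0"
  obtain h k where a: "a = (h, k)" by (cases a)
  have "(\<lambda>N. (real N + 2) / 2 ^ Suc N) \<longlonglongrightarrow> 0" by real_asymp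
  then have "eventually (\<lambda>N. (real N + 2) / 2 ^ Suc N < e) sequentially"
    using \<open>e > 0\<close> by (rule order_tendstoD)
  then obtain N where N: "(real N + 2) / 2 ^ Suc N < e" by (auto simp: eventually_sequentially)
  \<comment> \<open>All windows through \<open>k\<close> with at most \<open>N\<close> sites, each
    with all its roots; the base configuration is always \<open>h\<close>, since other cosets vanish
    at \<open>a\<close>.\<close>
  define F where "F = (SIGMA n:{1..N}. SIGMA p:{k - int n<..k}. {x. jac \<mu> x n = 0})"
  define u where "u = (\<lambda>(n, p, x). eig_fun \<mu> p n x h)"
  have fF: "finite F" unfolding F_def by (auto intro!: finite_SigmaI finite_jac_roots)
  have FD: "n > 0 \<and> jac \<mu> x n = 0" if "(n, p, x) \<in> F" for n p x using that by (auto simp: F_def)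
  define S where "S = insert a (\<Union>i\<in>F. {y. u i y \<noteq> 0})"
  have fS: "finite S" unfolding S_def u_def using fF finite_eig_fun_support by (auto simp: case_prod_unfold)
  have Sz: "u i y = 0" if "i \<in> F" "y \<notin> S" for i y using that by (auto simp: S_def)
  have on: "(\<Sum>y\<in>S. u i y * u j y) = (if i = j then 1 else 0)" if ij: "i \<in> F" "j \<in> F" for i j
  proof -
    obtain n p x n' p' x' where i: "i = (n, p, x)" and j: "j = (n', p', x')" by (cases i, cases j) auto
    have "(\<Sum>y\<in>S. u i y * u j y) = (\<Sum>\<^sub>\<infinity>y. u i y * u j y)"
      by (rule infsum_finite_support[symmetric, OF fS]) (use Sz ij in auto)
    then show ?thesis
      using eig_fun_inner[of n n' \<mu> x x' p h p' h] FD ij by (auto simp: i j u_def agree_off_def)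
  qed
  have "(\<Sum>i\<in>F. (u i a)\<^sup>2) = (\<Sum>n=1..N. \<Sum>p\<in>{k - int n<..k}. \<Sum>x | jac \<mu> x n = 0. (eig_fun \<mu> p n x h a)\<^sup>2)"
    unfolding F_def u_def by (simp add: sum.Sigma finite_jac_roots finite_SigmaI case_prod_unfold)
  also have "\<dots> = (\<Sum>n=1..N. \<Sum>p\<in>{k - int n<..k}. 1 / 2 ^ Suc n)"
  proof (intro sum.cong refl)
    fix n p assume p: "p \<in> {k - int n<..k}"
    have "(\<Sum>x | jac \<mu> x n = 0. (eig_fun \<mu> p n x h a)\<^sup>2) = (\<Sum>x | jac \<mu> x n = 0. (jvec \<mu> n x (nat (k - p)))\<^sup>2 * (1 / 2 ^ Suc n))"
      using p by (intro sum.cong refl)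
        (auto simp: a eig_fun_def power_mult_distrib window_char_sq agree_off_def)
    also have "\<dots> = 1 / 2 ^ Suc n"
      unfolding sum_distrib_right[symmetric] using p by (subst jvec_dual_norm) auto
    finally show "(\<Sum>x | jac \<mu> x n = 0. (eig_fun \<mu> p n x h a)\<^sup>2) = 1 / 2 ^ Suc n" .
  qed
  also have "\<dots> = (\<Sum>n=1..N. real n / 2 ^ Suc n)" by simp
  also have "\<dots> = 1 - (real N + 2) / 2 ^ Suc N" by (rule sum_window_weights)
  finally have total: "1 - (\<Sum>i\<in>F. (u i a)\<^sup>2) = (real N + 2) / 2 ^ Suc N" by simp
  define g where "g = (\<lambda>y. \<Sum>i\<in>F. complex_of_real (u i a) * of_real (u i y))"
  have gspan: "g \<in> fspan (eig_basis \<mu>)"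
    unfolding g_def using fF
    by (rule fspan_sum) (auto simp: eig_basis_def u_def dest!: FD)
  let ?d = "\<lambda>y. (if y = a then 1 else 0) - g y"
  have dz: "?d y = 0" if "y \<notin> S" for y
  proof -
    have "y \<noteq> a" using that unfolding S_def by blast
    moreover have "g y = 0" unfolding g_def using Sz that by (intro sum.neutral) auto
    ultimately show ?thesis by simp
  qed
  have "{y. ?d y \<noteq> 0} \<subseteq> S" using dz by blast
  then have ell: "?d \<in> ell2" by (intro ell2_finite_support finite_subset[OF _ fS])
  have "(\<Sum>\<^sub>\<infinity>y. (cmod (?d y))\<^sup>2) = (\<Sum>y\<in>S. (cmod (?d y))\<^sup>2)"
    by (rule infsum_finite_support[OF fS]) (simp add: dz)
  also have "\<dots> = (\<Sum>y\<in>S. ((if y = a then 1 else 0) - (\<Sum>i\<in>F. u i a * u i y))\<^sup>2)"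
  proof (intro sum.cong refl)
    fix y
    have "?d y = of_real ((if y = a then 1 else 0) - (\<Sum>i\<in>F. u i a * u i y))"
      by (simp add: g_def)
    then show "(cmod (?d y))\<^sup>2 = ((if y = a then 1 else 0) - (\<Sum>i\<in>F. u i a * u i y))\<^sup>2"
      by (simp only: norm_of_real power2_abs)
  qed
  also have "\<dots> = 1 - (\<Sum>i\<in>F. (u i a)\<^sup>2)"
    by (rule bessel_expand[OF fS fF _ on]) (simp_all add: S_def)
  finally have "(\<Sum>\<^sub>\<infinity>y. (cmod (?d y))\<^sup>2) < e" using total N by simp
  then show "\<exists>g\<in>fspan (eig_basis \<mu>). (\<lambda>y. (if y = a then 1 else 0) - g y) \<in> ell2
      \<and> (\<Sum>\<^sub>\<infinity>y. (cmod ((if y = a then 1 else 0) - g y))\<^sup>2) < e"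
    using gspan ell by blast
qed

lemma eig_basis: "ell2_orthonormal_basis (eig_basis \<mu>)"
  by (rule ell2_orthonormal_basisI[OF eig_basis_orthonormal delta_in_closure_eig_basis])

lemma eig_fun_eigenvector:
  assumes "n > 0" "jac \<mu> x n = 0"
  shows "eigenvector (walk_op \<mu>) (of_real (2 * x - \<mu>)) (\<lambda>y. of_real (eig_fun \<mu> p n x h y))"
  unfolding eigenvector_def
proof (intro conjI)
  show "(\<lambda>y. complex_of_real (eig_fun \<mu> p n x h y)) \<in> ell2"
    by (auto intro!: ell2_finite_support finite_eig_fun_support)
  show "(\<lambda>y. complex_of_real (eig_fun \<mu> p n x h y)) \<noteq> (\<lambda>y. 0)"
  proof
    assume "(\<lambda>y. complex_of_real (eig_fun \<mu> p n x h y)) = (\<lambda>y. 0)"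
    then have "eig_fun \<mu> p n x h y = 0" for y by (metis of_real_eq_0_iff)
    then show False using eig_fun_inner_same_window[OF assms(2) assms(2), of p h] by simp
  qed
qed (rule walk_op_eig_fun[OF assms])

lemma pure_point_walk_op: "pure_point_spectrum (walk_op \<mu>)"
  unfolding pure_point_spectrum_def
proof (intro exI[of _ "eig_basis \<mu>"] conjI ballI)
  fix v assume "v \<in> eig_basis \<mu>"
  then show "\<exists>z. eigenvector (walk_op \<mu>) z v"
    unfolding eig_basis_def using eig_fun_eigenvector by blast
qed (rule eig_basis)

text \<open>By symmetry an eigenvector for any other value is orthogonal to every basis element,
  hence zero. The basis functions are real, so the bilinear pairing is the inner product.\<close>

lemma eigenvalues_walk_op:
  "eigenvalues (walk_op \<mu>) = (\<lambda>x. complex_of_real (2 * x - \<mu>)) ` (\<Union>n\<in>{0<..}. {x. jac \<mu> x n = 0})"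
proof (intro equalityI subsetI)
  fix z assume "z \<in> (\<lambda>x. complex_of_real (2 * x - \<mu>)) ` (\<Union>n\<in>{0<..}. {x. jac \<mu> x n = 0})"
  then show "z \<in> eigenvalues (walk_op \<mu>)"
    unfolding eigenvalues_def using eig_fun_eigenvector by blast
next
  fix z assume "z \<in> eigenvalues (walk_op \<mu>)"
  then obtain v where v: "v \<in> ell2" "v \<noteq> (\<lambda>x. 0)" "walk_op \<mu> v = (\<lambda>y. z * v y)"
    unfolding eigenvalues_def eigenvector_def by blast
  show "z \<in> (\<lambda>x. complex_of_real (2 * x - \<mu>)) ` (\<Union>n\<in>{0<..}. {x. jac \<mu> x n = 0})"
  proof (rule ccontr)
    assume z: "\<not> ?thesis"
    have "ell2_inner v u = 0" if uB: "u \<in> eig_basis \<mu>" for u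
    proof -
      obtain p n x h where u: "u = (\<lambda>y. of_real (eig_fun \<mu> p n x h y))" "n > 0" "jac \<mu> x n = 0"
        using uB unfolding eig_basis_def by blast
      have "(\<Sum>\<^sub>\<infinity>y. walk_op \<mu> v y * u y) = (\<Sum>\<^sub>\<infinity>y. v y * walk_op \<mu> u y)"
        by (rule walk_op_symmetric) (simp add: u(1) finite_eig_fun_support)
      then have "z * (\<Sum>\<^sub>\<infinity>y. v y * u y) = of_real (2 * x - \<mu>) * (\<Sum>\<^sub>\<infinity>y. v y * u y)"
        unfolding v(3) u(1) walk_op_eig_fun[OF u(2,3)] infsum_cmult_right'[symmetric]
        by (simp add: mult_ac)
      moreover have "z \<noteq> of_real (2 * x - \<mu>)" using z u(2,3) by auto
      ultimately have "(\<Sum>\<^sub>\<infinity>y. v y * u y) = 0" by simp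
      then show ?thesis by (simp add: ell2_inner_def u(1))
    qed
    note orth = this
    have "v = (\<lambda>x. 0)"
    proof (rule ell2_orthogonal_basis_eq_0[OF eig_basis[of \<mu>] _ v(1) orth])
      show "finite {y. u y \<noteq> 0}" if "u \<in> eig_basis \<mu>" for u
        using that by (auto simp: eig_basis_def finite_eig_fun_support)
    qed
    then show False using v(2) by simp
  qed
qed

lemma eigenvalues_M_op:
  "eigenvalues (M_op \<mu>) = (\<lambda>x. complex_of_real (2 * x - \<mu>)) ` (\<Union>n\<in>{0<..}. {x. jac \<mu> x n = 0})"
  using eigenvalues_conjugate[where \<phi> = "\<lambda>x. inv\<^bsub>\<L>\<^esub> x" and S = "walk_op \<mu>" and T = "M_op \<mu>"]
  by (simp only: inv_inv_lamplighter M_op_conjugate eigenvalues_walk_op)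

lemma pure_point_M_op: "pure_point_spectrum (M_op \<mu>)"
  by (rule pure_point_spectrum_conjugate[where \<phi> = "\<lambda>x. inv\<^bsub>\<L>\<^esub> x" and S = "walk_op \<mu>"])
    (simp_all only: inv_inv_lamplighter M_op_conjugate pure_point_walk_op)

theorem theorem1:
  fixes \<mu> :: real
  defines "E \<equiv> eigenvalues (M_op \<mu>)"
    and "I \<equiv> {-4 - \<mu>..4 - \<mu>}"
  shows "pure_point_spectrum (M_op \<mu>)
    \<and> (\<bar>\<mu>\<bar> \<le> 1 \<longrightarrow>
         E \<subseteq> complex_of_real ` I \<and> complex_of_real ` I \<subseteq> closure E)
    \<and> (\<bar>\<mu>\<bar> > 1 \<longrightarrow>
         countable E
         \<and> complex_of_real ` I \<subseteq> closure (E \<inter> complex_of_real ` I)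
         \<and> complex_of_real (\<mu> + 2 / \<mu>) islimpt E
         \<and> \<mu> + 2 / \<mu> \<notin> I)"
proof -
  have E: "E = (\<lambda>x. complex_of_real (2 * x - \<mu>)) ` (\<Union>n\<in>{0<..}. {x. jac \<mu> x n = 0})"
    unfolding E_def by (rule eigenvalues_M_op)
  \<comment> \<open>This holds for every \<open>\<mu>\<close> and serves both cases. The affine map
    from \<open>x\<close> to \<open>2 * x - \<mu>\<close> carries \<open>[-2, 2]\<close> onto
    \<open>I\<close>.\<close>
  have dense: "complex_of_real ` I \<subseteq> closure (E \<inter> complex_of_real ` I)"
  proof
    fix z assume "z \<in> complex_of_real ` I"
    then obtain t where t: "z = of_real t" "t \<in> I" by blast
    show "z \<in> closure (E \<inter> complex_of_real ` I)"
      unfolding closure_approachable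
    proof (intro allI impI)
      fix e :: real assume "e > 0"
      have "\<bar>(t + \<mu>) / 2\<bar> \<le> 2" using t(2) by (auto simp: I_def abs_le_iff)
      then obtain n x where x: "n > 0" "jac \<mu> x n = 0" "\<bar>x\<bar> \<le> 2" "\<bar>x - (t + \<mu>) / 2\<bar> < e / 2"
        using jac_roots_dense[of "(t + \<mu>) / 2" "e / 2" \<mu>] \<open>e > 0\<close> by auto
      have "complex_of_real (2 * x - \<mu>) \<in> E" using x unfolding E by blast
      moreover have "2 * x - \<mu> \<in> I" using x(3) by (auto simp: I_def)
      moreover have "\<bar>2 * x - \<mu> - t\<bar> < e" using x(4) by (simp add: abs_less_iff field_simps)
      then have "dist (complex_of_real (2 * x - \<mu>)) z < e"
        unfolding t(1) dist_of_real by (simp only: dist_real_def)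
      ultimately show "\<exists>y\<in>E \<inter> complex_of_real ` I. dist y z < e" by blast
    qed
  qed
  have inside: "E \<subseteq> complex_of_real ` I" if "\<bar>\<mu>\<bar> \<le> 1"
  proof
    fix z assume "z \<in> E"
    then obtain n x where x: "jac \<mu> x n = 0" "z = complex_of_real (2 * x - \<mu>)" unfolding E by blast
    have "\<bar>x\<bar> \<le> 2" by (rule jac_eigen_bound[OF x(1) that])
    then have "2 * x - \<mu> \<in> I" by (auto simp: I_def)
    then show "z \<in> complex_of_real ` I" using x(2) by blast
  qed
  have count: "countable E"
    unfolding E by (intro countable_image countable_UN) (auto intro: countable_finite finite_jac_roots)
  have limpt: "complex_of_real (\<mu> + 2 / \<mu>) islimpt E" if m: "\<bar>\<mu>\<bar> > 1"
    unfolding islimpt_approachable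
  proof (intro allI impI)
    fix e :: real assume "e > 0"
    then obtain n x where x: "n > 0" "jac \<mu> x n = 0" "x \<noteq> \<mu> + 1 / \<mu>" "\<bar>x - (\<mu> + 1 / \<mu>)\<bar> < e / 2"
      using jac_outer_root_abs[OF m, of "e / 2"] by auto
    have eq: "2 * x - \<mu> - (\<mu> + 2 / \<mu>) = 2 * (x - (\<mu> + 1 / \<mu>))" by (simp add: algebra_simps)
    have "complex_of_real (2 * x - \<mu>) \<in> E" using x unfolding E by blast
    moreover have "2 * x - \<mu> \<noteq> \<mu> + 2 / \<mu>" using eq x(3) by auto
    moreover have "\<bar>2 * x - \<mu> - (\<mu> + 2 / \<mu>)\<bar> < e" 
      unfolding eq using x(4) by (subst abs_mult) (simp add: mult.commute)
    then have "dist (complex_of_real (2 * x - \<mu>)) (complex_of_real (\<mu> + 2 / \<mu>)) < e"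
      unfolding dist_of_real by (simp only: dist_real_def)
    ultimately show "\<exists>y\<in>E. y \<noteq> complex_of_real (\<mu> + 2 / \<mu>) \<and> dist y (complex_of_real (\<mu> + 2 / \<mu>)) < e"
      by (metis of_real_eq_iff)
  qed
  have outside: "\<mu> + 2 / \<mu> \<notin> I" if m: "\<bar>\<mu>\<bar> > 1"
  proof
    \<comment> \<open>Centring the interval at \<open>-\<mu>\<close> gives
      \<open>\<bar>\<mu> + 1 / \<mu>\<bar> \<le> 2\<close>, which contradicts the strict inequality
      of arithmetic and geometric means for \<open>\<bar>\<mu>\<bar> > 1\<close>.\<close>
    assume "\<mu> + 2 / \<mu> \<in> I"
    then have "\<bar>2 * (\<mu> + 1 / \<mu>)\<bar> \<le> 4" by (auto simp: I_def abs_le_iff)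
    then have "\<bar>\<mu> + 1 / \<mu>\<bar> \<le> 2" by (simp only: abs_mult) simp
    then have "\<bar>\<mu>\<bar> * \<bar>\<mu> + 1 / \<mu>\<bar> \<le> \<bar>\<mu>\<bar> * 2" by (intro mult_left_mono) auto
    also have "\<bar>\<mu>\<bar> * \<bar>\<mu> + 1 / \<mu>\<bar> = \<bar>\<mu> * \<mu> + 1\<bar>"
      using m by (simp add: abs_mult[symmetric] distrib_left)
    also have "\<dots> = \<bar>\<mu>\<bar> * \<bar>\<mu>\<bar> + 1" by simp
    finally have "(\<bar>\<mu>\<bar> - 1)\<^sup>2 \<le> 0" by (simp add: power2_eq_square algebra_simps)
    then show False using m by simp
  qed
  show ?thesis
    using pure_point_M_op dense inside count limpt outside
      closure_mono[of "E \<inter> complex_of_real ` I" E] by blast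
qed

end
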